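(* Let $X$ be a Cantor space and let $CT(X)$ be the set of chain transitive maps in $C_s(X)$. \begin{itemize} \item[(a)] If $\{ k_n \}$ is a divisibility sequence then $$\{ p_{n+1,n} : (\mathbb{Z}/k_{n+1}\mathbb{Z},\phi_{n+1}) \to (\mathbb{Z}/k_n \mathbb{Z}, \phi_n) : n \in \mathbb{N}\},$$ where $p_{n+1,n}$ is the canonical projection and $\phi_n$ is translation by $1$, is an invertible Shimomura sequence satisfying the factoring property, and so the associated adding machine is of residual type. \item[(b)] $CT(X)$ is a conjugacy transitive subset of $C_s(X)$, with the universal adding machine a transitive element of residual type. \item[(c)] For a chain transitive $g \in C_s(X)$, let $g_n \in C_s(X)$ be isomorphic to the $n!$-fold suspension of $g$. If $K_0$ is the union of the conjugacy classes of $g_1, g_2, \dots$, then $K_0$ is a dense subset of $CT(X)$. \end{itemize}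
   Context: A Cantor space is a nonempty, compact, zero-dimensional, perfect metric space; all Cantor spaces are homeomorphic and are identified with $X$ via homeomorphisms, so maps on them are regarded as elements of $C_s(X)$, well defined up to conjugacy. $\mathbb{N}$ is the set of positive integers. $C_s(X)$ is the space of continuous surjections $X\to X$ with the sup metric; the homeomorphism group $H(X)$ acts by $f\mapsto h\circ f\circ h^{-1}$, with orbits called conjugacy classes. $f\in C_s(X)$ is of residual type if its conjugacy class is a $G_\delta$ subset of $C_s(X)$. A closed, conjugacy invariant $K\subset C_s(X)$ is conjugacy transitive if it is the closure of the conjugacy class of some $f\in K$ (a transitive element of $K$). $f$ is chain transitive if for every $\epsilon>0$ and all $x,y\in X$ there is a finite sequence $x=x_0,\dots,x_n=y$, $n\ge1$, with $d(f(x_i),x_{i+1})<\epsilon$ for $0\le i<n$. The $N$-fold suspension of a map $g$ on $X$ is the map $g_N$ on $X\times\{1,\dots,N\}$ with $g_N(x,i)=(x,i+1)$ for $i<N$, $g_N(x,N)=(g(x),1)$. A divisibility sequence is a (strictly) increasing sequence $\{k_n\}_{n\in\mathbb{N}}$ of positive integers with $k_1=1$ and $k_n\mid k_{n+1}$ for all $n$. The associated adding machine is the inverse limit of $\{p_{n+1,n}:(\mathbb{Z}/k_{n+1}\mathbb{Z},\phi_{n+1})\to(\mathbb{Z}/k_n\mathbb{Z},\phi_n)\}$, i.e. translation by $1$ on $\varprojlim\mathbb{Z}/k_n\mathbb{Z}$. It is the universal adding machine when every positive integer divides $k_n$ for sufficiently large $n$ (e.g. $k_n=n!$). A system surjection $p:(I,\phi)\to(J,\psi)$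 between surjective relations on finite sets (subsets $\phi\subset I\times I$ with both projections onto) is a surjection $p:I\to J$ with $(p\times p)(\phi)=\psi$; maps are identified with their graphs. A sequence of system surjections $p_{n+1,n}:(I_{n+1},\phi_{n+1})\to(I_n,\phi_n)$ of finite systems (index sets identified with finite subsets of powers of $\mathbb{N}$) is a Shimomura sequence if, with $p_{m,n}=p_{n+1,n}\circ\cdots\circ p_{m,m-1}$: for every $n$, $x\in I_n$ there are $m>n$ and $y_1\ne y_2\in I_m$ with $p_{m,n}(y_1)=p_{m,n}(y_2)=x$; and for every $n$ there is $m>n$ such that $\{(a,p_{m,n}(b)):(a,b)\in\phi_m\}$ is a map. It is invertible if the latter condition also holds with all $\phi_n$ replaced by $\phi_n^{-1}$. It has the factoring property if whenever $k>n$ and $q_1:(I_k,\phi_k)\to(I_n,\phi_n)$ is a system surjection there exist $m>k$ and a system surjection $q_2:(I_m,\phi_m)\to(I_k,\phi_k)$ with $q_1\circ q_2=p_{m,n}$. *)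

theory Defs
  imports "HOL-Analysis.Analysis"
begin

section \<open>Continuous surjections of a Cantor space\<close>

text \<open>
  \<^term>\<open>X dim_le 0\<close> says that the clopen sets form a base (library lemma
  dimension_le_0_neighbourhood_base_of_clopen).
\<close>

definition cantor_space :: "'a::metric_space set \<Rightarrow> bool" where
  "cantor_space X \<longleftrightarrow>
     X \<noteq> {} \<and> compact X \<and> top_of_set X dim_le 0 \<and> (\<forall>x\<in>X. x islimpt X)"

text \<open>
  The Cantor space is the whole type. As it is compact, every continuous map is bounded, so
  the type of bounded continuous functions consists of all continuous self-maps and its
  distance is the sup metric.
\<close>

definition Cs :: "('a::metric_space \<Rightarrow>\<^sub>C 'a) set" where
  "Cs = {f. surj (apply_bcontfun f)}"

definition conj_class :: "('a::metric_space \<Rightarrow>\<^sub>C 'a) \<Rightarrow> ('a \<Rightarrow>\<^sub>C 'a) set" where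
  "conj_class f = {g \<in> Cs. \<exists>h h'. homeomorphism UNIV UNIV h h' \<and>
                      apply_bcontfun g = h \<circ> apply_bcontfun f \<circ> h'}"

definition residual_type :: "('a::metric_space \<Rightarrow>\<^sub>C 'a) \<Rightarrow> bool" where
  "residual_type f \<longleftrightarrow> f \<in> Cs \<and> gdelta_in (top_of_set Cs) (conj_class f)"

definition transitive_element ::
  "('a::metric_space \<Rightarrow>\<^sub>C 'a) set \<Rightarrow> ('a \<Rightarrow>\<^sub>C 'a) \<Rightarrow> bool" where
  "transitive_element K f \<longleftrightarrow> f \<in> K \<and> (top_of_set Cs) closure_of (conj_class f) = K"

definition conjugacy_transitive :: "('a::metric_space \<Rightarrow>\<^sub>C 'a) set \<Rightarrow> bool" where
  "conjugacy_transitive K \<longleftrightarrow>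
     closedin (top_of_set Cs) K \<and> (\<forall>f\<in>K. conj_class f \<subseteq> K) \<and> (\<exists>f. transitive_element K f)"

definition chain_transitive :: "('a::metric_space \<Rightarrow> 'a) \<Rightarrow> bool" where
  "chain_transitive f \<longleftrightarrow>
     (\<forall>\<epsilon>>0. \<forall>x y. \<exists>n\<ge>1. \<exists>c::nat \<Rightarrow> 'a. c 0 = x \<and> c n = y \<and>
        (\<forall>i<n. dist (f (c i)) (c (Suc i)) < \<epsilon>))"

definition CT :: "('a::metric_space \<Rightarrow>\<^sub>C 'a) set" where
  "CT = {f \<in> Cs. chain_transitive (apply_bcontfun f)}"

text \<open>
  A map \<open>f\<close> on another Cantor space (given as an abstract topology \<open>T\<close>) is regarded as an
  element of \<open>C\<^sub>s(X)\<close> by transporting it along a homeomorphism.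
\<close>

definition isomorphic_to ::
  "('a::metric_space \<Rightarrow>\<^sub>C 'a) \<Rightarrow> 'b topology \<Rightarrow> ('b \<Rightarrow> 'b) \<Rightarrow> bool" where
  "isomorphic_to F T f \<longleftrightarrow>
     (\<exists>h. homeomorphic_map T euclidean h \<and> (\<forall>x\<in>topspace T. h (f x) = apply_bcontfun F (h x)))"

definition suspension :: "nat \<Rightarrow> ('a \<Rightarrow> 'a) \<Rightarrow> 'a \<times> nat \<Rightarrow> 'a \<times> nat" where
  "suspension N g = (\<lambda>(x, i). if i < N then (x, i + 1) else (g x, 1))"

definition suspension_space :: "nat \<Rightarrow> ('a::metric_space \<times> nat) topology" where
  "suspension_space N = prod_topology euclidean (discrete_topology {1..N})"


section \<open>Sequences of finite systems\<close>

text \<open>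
  All sequences are indexed by the positive integers; values at index \<open>0\<close> are irrelevant.
  The bonding map \<open>p\<^sub>n\<^sub>+\<^sub>1\<^sub>,\<^sub>n\<close> is written \<open>p n\<close>.
\<close>

definition surjective_relation :: "'i set \<Rightarrow> ('i \<times> 'i) set \<Rightarrow> bool" where
  "surjective_relation I \<phi> \<longleftrightarrow> \<phi> \<subseteq> I \<times> I \<and> fst ` \<phi> = I \<and> snd ` \<phi> = I"

definition system_surjection ::
  "('i \<Rightarrow> 'j) \<Rightarrow> 'i set \<Rightarrow> ('i \<times> 'i) set \<Rightarrow> 'j set \<Rightarrow> ('j \<times> 'j) set \<Rightarrow> bool" where
  "system_surjection p I \<phi> J \<psi> \<longleftrightarrow> p ` I = J \<and> map_prod p p ` \<phi> = \<psi>"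

definition is_map_on :: "'i set \<Rightarrow> ('i \<times> 'j) set \<Rightarrow> bool" where
  "is_map_on I R \<longleftrightarrow> (\<forall>a\<in>I. \<exists>!c. (a, c) \<in> R)"

definition graph_on :: "'i set \<Rightarrow> ('i \<Rightarrow> 'j) \<Rightarrow> ('i \<times> 'j) set" where
  "graph_on I f = {(x, f x) | x. x \<in> I}"

text \<open>\<open>bond p m n\<close> is \<open>p\<^sub>m\<^sub>,\<^sub>n = p\<^sub>n\<^sub>+\<^sub>1\<^sub>,\<^sub>n \<circ> \<dots> \<circ> p\<^sub>m\<^sub>,\<^sub>m\<^sub>-\<^sub>1\<close> for \<open>m > n\<close>, and the identity otherwise.\<close>

primrec bond :: "(nat \<Rightarrow> 'i \<Rightarrow> 'i) \<Rightarrow> nat \<Rightarrow> nat \<Rightarrow> 'i \<Rightarrow> 'i" where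
  "bond p 0 n = id"
| "bond p (Suc m) n = (if n \<le> m then bond p m n \<circ> p m else id)"

definition system_sequence ::
  "(nat \<Rightarrow> 'i set) \<Rightarrow> (nat \<Rightarrow> ('i \<times> 'i) set) \<Rightarrow> (nat \<Rightarrow> 'i \<Rightarrow> 'i) \<Rightarrow> bool" where
  "system_sequence I \<phi> p \<longleftrightarrow>
     (\<forall>n\<ge>1. finite (I n) \<and> surjective_relation (I n) (\<phi> n)) \<and>
     (\<forall>n\<ge>1. system_surjection (p n) (I (Suc n)) (\<phi> (Suc n)) (I n) (\<phi> n))"

definition eventually_map ::
  "(nat \<Rightarrow> 'i set) \<Rightarrow> (nat \<Rightarrow> ('i \<times> 'i) set) \<Rightarrow> (nat \<Rightarrow> 'i \<Rightarrow> 'i) \<Rightarrow> bool" where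
  "eventually_map I \<phi> p \<longleftrightarrow>
     (\<forall>n\<ge>1. \<exists>m>n. is_map_on (I m) {(a, bond p m n b) | a b. (a, b) \<in> \<phi> m})"

definition shimomura_sequence ::
  "(nat \<Rightarrow> 'i set) \<Rightarrow> (nat \<Rightarrow> ('i \<times> 'i) set) \<Rightarrow> (nat \<Rightarrow> 'i \<Rightarrow> 'i) \<Rightarrow> bool" where
  "shimomura_sequence I \<phi> p \<longleftrightarrow>
     system_sequence I \<phi> p \<and>
     (\<forall>n\<ge>1. \<forall>x\<in>I n. \<exists>m>n. \<exists>y1\<in>I m. \<exists>y2\<in>I m. y1 \<noteq> y2 \<and> bond p m n y1 = x \<and> bond p m n y2 = x) \<and>
     eventually_map I \<phi> p"

definition invertible_shimomura_sequence ::
  "(nat \<Rightarrow> 'i set) \<Rightarrow> (nat \<Rightarrow> ('i \<times> 'i) set) \<Rightarrow> (nat \<Rightarrow> 'i \<Rightarrow> 'i) \<Rightarrow> bool" where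
  "invertible_shimomura_sequence I \<phi> p \<longleftrightarrow>
     shimomura_sequence I \<phi> p \<and> eventually_map I (\<lambda>n. (\<phi> n)\<inverse>) p"

definition factoring_property ::
  "(nat \<Rightarrow> 'i set) \<Rightarrow> (nat \<Rightarrow> ('i \<times> 'i) set) \<Rightarrow> (nat \<Rightarrow> 'i \<Rightarrow> 'i) \<Rightarrow> bool" where
  "factoring_property I \<phi> p \<longleftrightarrow>
     (\<forall>n\<ge>1. \<forall>k>n. \<forall>q1. system_surjection q1 (I k) (\<phi> k) (I n) (\<phi> n) \<longrightarrow>
        (\<exists>m>k. \<exists>q2. system_surjection q2 (I m) (\<phi> m) (I k) (\<phi> k) \<and>
           (\<forall>x\<in>I m. q1 (q2 x) = bond p m n x)))"

definition inverse_limit ::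
  "(nat \<Rightarrow> 'i set) \<Rightarrow> (nat \<Rightarrow> 'i \<Rightarrow> 'i) \<Rightarrow> (nat \<Rightarrow> 'i) topology" where
  "inverse_limit I p =
     subtopology (product_topology (\<lambda>n. discrete_topology (I n)) {1..})
       {x. \<forall>n\<ge>1. p n (x (Suc n)) = x n}"

text \<open>The map induced on the inverse limit when each system is given by a map \<open>t n\<close> on \<open>I n\<close>.\<close>

definition inverse_limit_map :: "(nat \<Rightarrow> 'i \<Rightarrow> 'i) \<Rightarrow> (nat \<Rightarrow> 'i) \<Rightarrow> (nat \<Rightarrow> 'i)" where
  "inverse_limit_map t x = (\<lambda>n\<in>{1..}. t n (x n))"


section \<open>Adding machines\<close>

definition divisibility_sequence :: "(nat \<Rightarrow> nat) \<Rightarrow> bool" where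
  "divisibility_sequence k \<longleftrightarrow>
     k 1 = 1 \<and> (\<forall>n\<ge>1. 0 < k n \<and> k n < k (Suc n) \<and> k n dvd k (Suc n))"

definition universal_sequence :: "(nat \<Rightarrow> nat) \<Rightarrow> bool" where
  "universal_sequence k \<longleftrightarrow>
     divisibility_sequence k \<and> (\<forall>j\<ge>1. \<forall>\<^sub>F n in sequentially. j dvd k n)"

text \<open>\<open>\<int>/k\<^sub>n\<int>\<close> is represented by the residues \<open>0, \<dots>, k\<^sub>n - 1\<close>.\<close>

definition cyc :: "(nat \<Rightarrow> nat) \<Rightarrow> nat \<Rightarrow> nat set" where
  "cyc k n = {0..<k n}"

definition cyc_shift :: "(nat \<Rightarrow> nat) \<Rightarrow> nat \<Rightarrow> nat \<Rightarrow> nat" where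
  "cyc_shift k n x = (x + 1) mod k n"

definition cyc_rel :: "(nat \<Rightarrow> nat) \<Rightarrow> nat \<Rightarrow> (nat \<times> nat) set" where
  "cyc_rel k n = graph_on (cyc k n) (cyc_shift k n)"

definition cyc_proj :: "(nat \<Rightarrow> nat) \<Rightarrow> nat \<Rightarrow> nat \<Rightarrow> nat" where
  "cyc_proj k n x = x mod k n"

definition adding_machine_space :: "(nat \<Rightarrow> nat) \<Rightarrow> (nat \<Rightarrow> nat) topology" where
  "adding_machine_space k = inverse_limit (cyc k) (cyc_proj k)"

definition adding_machine :: "(nat \<Rightarrow> nat) \<Rightarrow> (nat \<Rightarrow> nat) \<Rightarrow> (nat \<Rightarrow> nat)" where
  "adding_machine k = inverse_limit_map (cyc_shift k)"

lemma universal_sequence_fact: "universal_sequence fact"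
proof -
  have "\<forall>\<^sub>F n in sequentially. j dvd fact n" if "j \<ge> 1" for j :: nat
    using eventually_ge_at_top[of j] by eventually_elim (use that in \<open>auto intro: dvd_fact\<close>)
  then show ?thesis
    by (auto simp: universal_sequence_def divisibility_sequence_def)
qed

end

theory Submission
  imports Defs
begin

text \<open>
  The proof rests on one notion: a cyclic factor of length \<open>L\<close> of a map \<open>f\<close>, which is a partition of the
  Cantor space into \<open>L\<close> clopen sets that \<open>f\<close> permutes cyclically.

  Topology enters through towers of partitions. For every divisibility sequence \<open>k\<close> a nonempty clopen set
  can be partitioned successively into \<open>k 1\<close>, then \<open>k 2\<close>, then \<open>k 3\<close> nonempty clopen sets, and so on, so that each partition refines
  the previous one in the pattern of \<open>\<int>/k\<^sub>n\<int>\<close> and all points are separated in the end. It is therefore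
  homeomorphic to the adding machine space of \<open>k\<close> (\<open>clopen_homeomorphic_adding_machine_space\<close>). This
  provides copies of all adding machines and suspensions, and it shows that nonempty clopen sets are
  homeomorphic to each other, so that partitions can be moved around by homeomorphisms.

  An adding machine is determined by its cyclic factors. If \<open>f\<close> has, for every \<open>\<epsilon>\<close>, a cyclic factor with
  pieces of diameter below \<open>\<epsilon>\<close> and of a length \<open>k m\<close> with \<open>m\<close> arbitrarily large, then all orbits of \<open>f\<close> are
  dense. Hence a cyclic factor is determined by its length and its value at a base point, the given
  factors fit together to a tower, and \<open>f\<close> is conjugate to the adding machine. For fixed \<open>\<epsilon>\<close> the condition
  is open in the sup metric, as a partition that \<open>f\<close> permutes is permuted in the same way by all maps
  near \<open>f\<close>. So the conjugacy class of the adding machine is a countable intersection of open sets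
  (\<open>adding_machine_residual_type\<close>).

  Density comes from \<open>conjugate_approximates_chain_transitive\<close>. A chain transitive map \<open>f\<close> is described up to
  \<open>\<epsilon>\<close> by a closed pseudo-orbit of some length \<open>L\<close> through all pieces of a fine partition, and every \<open>F\<close>
  with a cyclic factor of length \<open>L\<close> can be conjugated so as to follow this pseudo-orbit. A map, or a
  family of maps, that has cyclic factors of all lengths thus has conjugates near every element of \<open>CT\<close>.
  The universal adding machine has them because each \<open>L\<close> divides some \<open>k n\<close>, and the suspensions of order
  \<open>n!\<close> have them because \<open>L\<close> divides \<open>L!\<close> and the level of a suspension is a cyclic factor. As \<open>CT\<close> is closed
  and conjugacy invariant, it is the closure of these conjugacy classes.

  The combinatorial claims about \<open>\<int>/k\<^sub>n\<int>\<close> reduce to the fact that a system surjection of cyclic groups is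
  reduction composed with a translation.
\<close>

section \<open>Continuous maps to the natural numbers\<close>

lemma continuous_on_nat_iff:
  fixes q :: "'a::topological_space \<Rightarrow> nat"
  shows "continuous_on UNIV q \<longleftrightarrow> (\<forall>i. open {x. q x = i})"
proof
  assume q: "continuous_on UNIV q"
  show "\<forall>i. open {x. q x = i}"
  proof
    fix i
    have "open (q -` {i})"
      using q by (intro open_vimage) (auto simp: open_discrete)
    then show "open {x. q x = i}"
      by (simp add: vimage_def)
  qed
next
  assume q: "\<forall>i. open {x. q x = i}"
  have "open (q -` B)" for B
  proof -
    have "q -` B = (\<Union>i\<in>B. {x. q x = i})"
      by auto
    then show ?thesis
      using q by auto
  qed
  then show "continuous_on UNIV q"
    by (simp add: continuous_on_open_vimage)
qed

lemma continuous_map_nat_iff: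
  "continuous_map T (discrete_topology UNIV) (q :: 'a \<Rightarrow> nat) \<longleftrightarrow> continuous_map T euclidean q"
proof -
  have "discrete_topology UNIV = (euclidean :: nat topology)"
    by (simp add: discrete_topology_unique open_discrete)
  then show ?thesis
    by simp
qed

lemma continuous_map_colour:
  assumes "continuous_on UNIV (q :: 'a::topological_space \<Rightarrow> nat)"
  shows "continuous_map euclidean (discrete_topology UNIV) q"
  using assms by (simp add: continuous_map_nat_iff)

lemma continuous_on_nat_comp:
  fixes q :: "'a::topological_space \<Rightarrow> nat" and r :: "nat \<Rightarrow> 'b::topological_space"
  assumes "continuous_on UNIV q"
  shows "continuous_on UNIV (\<lambda>x. r (q x))"
  using continuous_on_compose2[OF Topological_Spaces.continuous_on_discrete assms, of UNIV r] by simp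

lemma clopen_colour:
  fixes q :: "'a::topological_space \<Rightarrow> nat"
  assumes "continuous_on UNIV q"
  shows "open {x. q x = i}" and "closed {x. q x = i}"
proof -
  show "open {x. q x = i}"
    using assms by (simp add: continuous_on_nat_iff)
  have "closed (q -` {i})"
    using assms by (intro closed_vimage) auto
  then show "closed {x. q x = i}"
    by (simp add: vimage_def)
qed

lemma continuous_on_nat_if:
  fixes q r :: "'a::topological_space \<Rightarrow> nat"
  assumes "open C" "closed C" "continuous_on UNIV q" "continuous_on UNIV r"
  shows "continuous_on UNIV (\<lambda>x. if x \<in> C then q x else r x)"
  unfolding continuous_on_nat_iff
proof
  fix i
  have "{x. (if x \<in> C then q x else r x) = i} = (C \<inter> {x. q x = i}) \<union> (- C \<inter> {x. r x = i})"
    by auto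
  then show "open {x. (if x \<in> C then q x else r x) = i}"
    using assms by (auto simp: clopen_colour open_Compl intro!: open_Un open_Int)
qed

text \<open>
  A continuous colouring of a compact space has clopen colour classes at positive distance from each
  other. This is what turns sup-closeness of maps into equality of colours.
\<close>

lemma uniform_colour:
  fixes q :: "'a::metric_space \<Rightarrow> nat"
  assumes X: "compact (UNIV :: 'a set)" and q: "continuous_on UNIV q"
  obtains \<delta> where "\<delta> > 0" "\<And>x y. dist x y < \<delta> \<Longrightarrow> q x = q y"
proof -
  have "continuous_on UNIV (\<lambda>x. real (q x))"
    using q by (rule continuous_on_of_nat)
  then have "uniformly_continuous_on UNIV (\<lambda>x. real (q x))"
    using X by (rule compact_uniformly_continuous)
  then obtain \<delta> where "\<delta> > 0" "\<And>x y. dist x y < \<delta> \<Longrightarrow> dist (real (q x)) (real (q y)) < 1"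
    unfolding uniformly_continuous_on_def by (metis UNIV_I zero_less_one)
  moreover have "q x = q y" if "dist (real (q x)) (real (q y)) < 1" for x y
    using that by (simp add: dist_real_def)
  ultimately show thesis
    using that[of \<delta>] by blast
qed

text \<open>
  Two spaces partitioned into clopen pieces with the same labels are homeomorphic by a label preserving
  map as soon as corresponding pieces are: the piecewise map is continuous because the pieces are open.
  Labels missing on both sides give empty pieces, which are homeomorphic.
\<close>

lemma homeomorphic_map_by_colour:
  fixes p :: "'a \<Rightarrow> 'c" and q :: "'b \<Rightarrow> 'c"
  assumes p: "continuous_map S (discrete_topology UNIV) p"
    and q: "continuous_map T (discrete_topology UNIV) q"
    and fib: "\<And>i. subtopology S {x \<in> topspace S. p x = i} homeomorphic_space
                  subtopology T {y \<in> topspace T. q y = i}"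
  obtains h where "homeomorphic_map S T h" "\<And>x. x \<in> topspace S \<Longrightarrow> q (h x) = p x"
proof -
  let ?S = "\<lambda>i. {x \<in> topspace S. p x = i}" and ?T = "\<lambda>i. {y \<in> topspace T. q y = i}"
  have "\<forall>i. \<exists>h g. homeomorphic_maps (subtopology S (?S i)) (subtopology T (?T i)) h g"
    using fib by (simp add: homeomorphic_space_def)
  then obtain h g where hg: "\<And>i. homeomorphic_maps (subtopology S (?S i)) (subtopology T (?T i)) (h i) (g i)"
    by metis
  have h: "continuous_map (subtopology S (?S i)) (subtopology T (?T i)) (h i)"
    and g: "continuous_map (subtopology T (?T i)) (subtopology S (?S i)) (g i)" for i
    using hg[of i] by (auto simp: homeomorphic_maps_def)
  have ph: "h (p x) x \<in> topspace T \<and> q (h (p x) x) = p x" if "x \<in> topspace S" for x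
    using h[of "p x"] that by (auto simp: continuous_map_def Pi_iff)
  have qg: "g (q y) y \<in> topspace S \<and> p (g (q y) y) = q y" if "y \<in> topspace T" for y
    using g[of "q y"] that by (auto simp: continuous_map_def Pi_iff)
  have "openin S (?S i)" "openin T (?T i)" for i
    using openin_continuous_map_preimage[OF p, of "{i}"] openin_continuous_map_preimage[OF q, of "{i}"]
    by auto
  note ope = this
  have "continuous_map S T (\<lambda>x. h (p x) x)"
    by (rule pasting_lemma[where I = UNIV and T = ?S and f = h])
      (use ope h in \<open>auto simp: continuous_map_in_subtopology\<close>)
  moreover have "continuous_map T S (\<lambda>y. g (q y) y)"
    by (rule pasting_lemma[where I = UNIV and T = ?T and f = g])
      (use ope g in \<open>auto simp: continuous_map_in_subtopology\<close>)
  moreover have "g (q (h (p x) x)) (h (p x) x) = x" if "x \<in> topspace S" for x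
    using hg[of "p x"] ph[OF that] that by (auto simp: homeomorphic_maps_def)
  moreover have "h (p (g (q y) y)) (g (q y) y) = y" if "y \<in> topspace T" for y
    using hg[of "q y"] qg[OF that] that by (auto simp: homeomorphic_maps_def)
  ultimately have "homeomorphic_maps S T (\<lambda>x. h (p x) x) (\<lambda>y. g (q y) y)"
    by (simp add: homeomorphic_maps_def)
  then show thesis
    using ph by (intro that[of "\<lambda>x. h (p x) x"]) (auto simp: homeomorphic_map_maps)
qed

section \<open>Colourings of a Cantor space\<close>

lemma cantor_spaceD:
  assumes "cantor_space (UNIV :: 'a::metric_space set)"
  shows "compact (UNIV :: 'a set)" "\<And>x :: 'a. x islimpt UNIV"
  using assms by (auto simp: cantor_space_def)

lemma cantor_clopen_neighbourhood:
  assumes X: "cantor_space (UNIV :: 'a::metric_space set)" and W: "open W" "(x::'a) \<in> W"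
  obtains C where "open C" "closed C" "x \<in> C" "C \<subseteq> W"
proof -
  have "neighbourhood_base_of (\<lambda>U. closedin euclidean U \<and> openin euclidean U) (euclidean :: 'a topology)"
    using X by (simp add: cantor_space_def dimension_le_0_neighbourhood_base_of_clopen)
  then show thesis
    using W that unfolding neighbourhood_base_of open_openin[symmetric] closed_closedin[symmetric]
    by (metis subsetD)
qed

text \<open>
  A finite cover by small clopen sets becomes a partition when each point is coloured by the first set
  of the cover that contains it.
\<close>

lemma fine_colouring:
  assumes X: "cantor_space (UNIV :: 'a::metric_space set)" and e: "e > 0"
  obtains q :: "'a::metric_space \<Rightarrow> nat" where "continuous_on UNIV q" "\<And>x y. q x = q y \<Longrightarrow> dist x y < e"
proof -
  have "\<forall>x::'a. \<exists>C. open C \<and> closed C \<and> x \<in> C \<and> C \<subseteq> ball x (e/2)"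
  proof
    fix x :: 'a
    show "\<exists>C. open C \<and> closed C \<and> x \<in> C \<and> C \<subseteq> ball x (e/2)"
      using cantor_clopen_neighbourhood[OF X, of "ball x (e/2)" x] e by (metis centre_in_ball half_gt_zero open_ball)
  qed
  then obtain C where C: "\<And>x::'a. open (C x) \<and> closed (C x) \<and> x \<in> C x \<and> C x \<subseteq> ball x (e/2)"
    by metis
  obtain D where D: "finite D" "UNIV = (\<Union>x\<in>D. C x)"
    using compactE_image[OF cantor_spaceD(1)[OF X], of UNIV C] C by (metis UNIV_I UNIV_eq_I UN_iff subset_UNIV top.extremum_uniqueI)
  obtain a where a: "bij_betw a {0..<card D} D"
    using ex_bij_betw_nat_finite[OF D(1)] by blast
  define q where "q x = (LEAST i. i < card D \<and> x \<in> C (a i))" for x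
  have q: "q x < card D \<and> x \<in> C (a (q x))" for x
  proof -
    have "\<exists>i<card D. x \<in> C (a i)"
    proof -
      obtain z where z: "z \<in> D" "x \<in> C z"
        using D(2) by blast
      then have "z \<in> a ` {0..<card D}"
        using a by (simp add: bij_betw_def)
      then show ?thesis
        using z by auto
    qed
    then show ?thesis
      unfolding q_def by (rule LeastI_ex)
  qed
  have "continuous_on UNIV q"
    unfolding continuous_on_nat_iff
  proof
    fix i
    have "{x. q x = i} = (if i < card D then C (a i) - (\<Union>j<i. C (a j)) else {})"
    proof -
      have "q x = i \<longleftrightarrow> i < card D \<and> x \<in> C (a i) \<and> (\<forall>j<i. x \<notin> C (a j))" for x
      proof
        assume "q x = i"
        then show "i < card D \<and> x \<in> C (a i) \<and> (\<forall>j<i. x \<notin> C (a j))"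
          using q[of x] not_less_Least[of _ "\<lambda>i. i < card D \<and> x \<in> C (a i)"]
          unfolding q_def by (meson dual_order.strict_trans)
      next
        assume "i < card D \<and> x \<in> C (a i) \<and> (\<forall>j<i. x \<notin> C (a j))"
        then show "q x = i"
          unfolding q_def by (intro Least_equality) (auto simp: not_less[symmetric])
      qed
      then show ?thesis
        by auto
    qed
    then show "open {x. q x = i}"
      using C by (auto intro!: open_Diff closed_UN)
  qed
  moreover have "dist x y < e" if "q x = q y" for x y
  proof -
    have "dist (a (q x)) x < e/2" "dist (a (q x)) y < e/2"
      using q[of x] q[of y] C that by (metis mem_ball subsetD)+
    then show ?thesis
      using dist_triangle3[of x y "a (q x)"] by linarith
  qed
  ultimately show thesis
    using that by blast
qed

text \<open>
  Splitting off one piece at a time never gets stuck: a nonempty open set contains two points, as no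
  point is isolated, and a clopen neighbourhood of the first that misses the second leaves a nonempty
  remainder.
\<close>

lemma split_clopen:
  assumes X: "cantor_space (UNIV :: 'a::metric_space set)" and r: "r \<ge> 1"
    and U: "open U" "closed U" "(U::'a set) \<noteq> {}"
  shows "\<exists>d :: 'a \<Rightarrow> nat. continuous_on UNIV d \<and> d ` U = {0..<r}"
  using r U
proof (induction r arbitrary: U rule: dec_induct)
  case base
  then show ?case
    by (intro exI[of _ "\<lambda>_. 0"]) auto
next
  case (step r)
  obtain x where x: "x \<in> U"
    using step.prems by blast
  obtain y where y: "y \<in> U" "y \<noteq> x"
    using cantor_spaceD(2)[OF X, of x] step.prems(1) x unfolding islimpt_def by blast
  obtain C where C: "open C" "closed C" "x \<in> C" "C \<subseteq> U - {y}"
    using cantor_clopen_neighbourhood[OF X, of "U - {y}" x] step.prems(1) x y by blast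
  have "open (U - C)" "closed (U - C)" "U - C \<noteq> {}"
    using C step.prems y by (auto simp: open_Diff closed_Diff)
  then obtain d :: "'a \<Rightarrow> nat" where d: "continuous_on UNIV d" "d ` (U - C) = {0..<r}"
    using step.IH[of "U - C"] by blast
  have "(\<lambda>x. if x \<in> C then r else d x) ` U = insert r (d ` (U - C))"
    using C by auto
  then show ?case
    using d C by (intro exI[of _ "\<lambda>x. if x \<in> C then r else d x"])
      (auto intro!: continuous_on_nat_if)
qed

text \<open>
  Prescribing the number of pieces leaves enough freedom to separate \<open>B\<close> from its complement: one
  piece is reserved for the points of \<open>B\<close>, the others divide the rest. Two pieces are needed for this,
  which is where the strict increase of a divisibility sequence will enter.
\<close>

lemma split_clopen_along:
  assumes X: "cantor_space (UNIV :: 'a::metric_space set)" and r: "r \<ge> 2"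
    and U: "open U" "closed U" "(U::'a set) \<noteq> {}" and B: "open B" "closed B"
  shows "\<exists>d :: 'a \<Rightarrow> nat. continuous_on UNIV d \<and> d ` U = {0..<r} \<and>
           (\<forall>x\<in>U. \<forall>y\<in>U. d x = d y \<longrightarrow> (x \<in> B \<longleftrightarrow> y \<in> B))"
proof (cases "U \<inter> B = {} \<or> U \<subseteq> B")
  case True
  then show ?thesis
    using split_clopen[OF X _ U, of r] r by fastforce
next
  case False
  then have "open (U - B)" "closed (U - B)" "U - B \<noteq> {}"
    using U B by (auto simp: open_Diff closed_Diff)
  moreover have "1 \<le> r - 1"
    using r by simp
  ultimately obtain d :: "'a \<Rightarrow> nat" where d: "continuous_on UNIV d" "d ` (U - B) = {0..<r-1}"
    using split_clopen[OF X, of "r - 1" "U - B"] by blast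
  let ?d = "\<lambda>x. if x \<in> B then r - 1 else d x"
  have "?d ` U = insert (r - 1) (d ` (U - B))"
    using False by auto
  then have "?d ` U = {0..<r}"
    using d r by auto
  moreover have "d x \<noteq> r - 1" if "x \<in> U - B" for x
    using d(2) that by (metis atLeastLessThan_iff image_eqI less_irrefl)
  then have "\<forall>x\<in>U. \<forall>y\<in>U. ?d x = ?d y \<longrightarrow> (x \<in> B \<longleftrightarrow> y \<in> B)"
    by (metis DiffI)
  ultimately show ?thesis
    using d B by (intro exI[of _ ?d]) (auto intro!: continuous_on_nat_if)
qed

text \<open>
  One step up the tower \<open>\<int>/K\<int> \<leftarrow> \<int>/Kr\<int>\<close>: a residue modulo \<open>K * r\<close> is a residue modulo \<open>K\<close> together
  with a digit below \<open>r\<close>, and the digit subdivides each colour class separately.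
\<close>

lemma refine_colouring:
  assumes X: "cantor_space (UNIV :: 'a::metric_space set)" and r: "r \<ge> 2"
    and U: "open U" "closed U" and B: "open B" "closed (B::'a set)"
    and c: "continuous_on UNIV c" "c ` U = {0..<K}"
  shows "\<exists>c' :: 'a \<Rightarrow> nat. continuous_on UNIV c' \<and> c' ` U = {0..<K * r} \<and>
           (\<forall>x\<in>U. c' x mod K = c x) \<and>
           (\<forall>x\<in>U. \<forall>y\<in>U. c' x = c' y \<longrightarrow> (x \<in> B \<longleftrightarrow> y \<in> B))"
proof -
  let ?U = "\<lambda>i. U \<inter> {x. c x = i}"
  have cK: "c x < K" if "x \<in> U" for x
    using c(2) that by (metis atLeastLessThan_iff image_eqI)
  have "\<forall>i. \<exists>d :: 'a \<Rightarrow> nat. continuous_on UNIV d \<and> (i < K \<longrightarrow> d ` ?U i = {0..<r} \<and>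
           (\<forall>x\<in>?U i. \<forall>y\<in>?U i. d x = d y \<longrightarrow> (x \<in> B \<longleftrightarrow> y \<in> B)))"
  proof
    fix i
    show "\<exists>d :: 'a \<Rightarrow> nat. continuous_on UNIV d \<and> (i < K \<longrightarrow> d ` ?U i = {0..<r} \<and>
           (\<forall>x\<in>?U i. \<forall>y\<in>?U i. d x = d y \<longrightarrow> (x \<in> B \<longleftrightarrow> y \<in> B)))"
    proof (cases "i < K")
      case True
      then have "i \<in> c ` U"
        using c(2) by simp
      then have "?U i \<noteq> {}"
        by auto
      then show ?thesis
        using split_clopen_along[OF X r open_Int[OF U(1) clopen_colour(1)[OF c(1)]]
            closed_Int[OF U(2) clopen_colour(2)[OF c(1)]] _ B, of i] by blast
    qed (auto intro!: exI[of _ "\<lambda>_. 0"])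
  qed
  then obtain d :: "nat \<Rightarrow> 'a \<Rightarrow> nat" where d: "\<And>i. continuous_on UNIV (d i)"
    and dU: "\<And>i. i < K \<Longrightarrow> d i ` ?U i = {0..<r}"
    and dB: "\<And>i x y. i < K \<Longrightarrow> x \<in> ?U i \<Longrightarrow> y \<in> ?U i \<Longrightarrow> d i x = d i y \<Longrightarrow> x \<in> B \<longleftrightarrow> y \<in> B"
    by metis
  \<comment> \<open>The old colour is the low digit, so reduction modulo \<open>K\<close> recovers it.\<close>
  define c' where "c' x = c x + K * d (c x) x" for x
  have "continuous_on UNIV c'"
    unfolding continuous_on_nat_iff
  proof
    fix v
    have "{x. c' x = v} = (\<Union>i. {x. c x = i} \<inter> {x. i + K * d i x = v})"
      by (auto simp: c'_def)
    moreover have "open {x. i + K * d i x = v}" for i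
      using continuous_on_nat_comp[OF d[of i], of "\<lambda>m. i + K * m"] by (rule clopen_colour)
    ultimately show "open {x. c' x = v}"
      using clopen_colour(1)[OF c(1)] by (auto intro!: open_UN open_Int simp del: Un_iff)
  qed
  moreover have mod: "c' x mod K = c x" and div: "c' x div K = d (c x) x" if "x \<in> U" for x
    using cK[OF that] by (auto simp: c'_def)
  moreover have "c' ` U = {0..<K * r}"
  proof (intro equalityI subsetI)
    fix v assume "v \<in> c' ` U"
    then obtain x where x: "x \<in> U" "v = c' x"
      by auto
    have "d (c x) x \<in> d (c x) ` ?U (c x)"
      using x by auto
    then have "d (c x) x < r"
      using dU[OF cK[OF x(1)]] by simp
    then have "v < K * Suc (d (c x) x)" "K * Suc (d (c x) x) \<le> K * r"
      using cK[OF x(1)] unfolding x(2) c'_def by (auto simp del: mult_Suc_right intro: mult_le_mono2) simp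
    then show "v \<in> {0..<K * r}"
      by simp
  next
    fix v assume "v \<in> {0..<K * r}"
    then have v: "v < K * r"
      by simp
    then have "v mod K < K" "v div K < r"
      by (auto simp: less_mult_imp_div_less mult.commute intro!: mod_less_divisor gr0I)
    then have "v div K \<in> d (v mod K) ` ?U (v mod K)"
      using dU by simp
    then obtain x where "x \<in> U" "c x = v mod K" "d (v mod K) x = v div K"
      by auto
    then show "v \<in> c' ` U"
      by (intro image_eqI[of _ _ x]) (auto simp: c'_def)
  qed
  moreover have "x \<in> B \<longleftrightarrow> y \<in> B" if "x \<in> U" "y \<in> U" "c' x = c' y" for x y
    using dB[of "c x" x y] mod[OF that(1)] mod[OF that(2)] div[OF that(1)] div[OF that(2)] that cK[OF that(1)]
    by simp
  ultimately show ?thesis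
    by (intro exI[of _ c']) blast
qed

section \<open>Residue towers and the adding machine space\<close>

lemma divisibility_sequence_pos:
  "divisibility_sequence k \<Longrightarrow> n \<ge> 1 \<Longrightarrow> 0 < k n"
  by (simp add: divisibility_sequence_def)

lemma divisibility_sequence_dvd:
  assumes k: "divisibility_sequence k" and "1 \<le> m" "m \<le> n"
  shows "k m dvd k n"
  using assms(3)
proof (induction n rule: dec_induct)
  case (step n)
  then show ?case
    using k assms(2) by (auto simp: divisibility_sequence_def intro: dvd_trans)
qed simp

lemma divisibility_sequence_mult:
  assumes k: "divisibility_sequence k" and n: "n \<ge> 1"
  obtains r where "r \<ge> 2" "k (Suc n) = k n * r"
proof -
  obtain r where r: "k (Suc n) = k n * r"
    using k n by (auto simp: divisibility_sequence_def elim: dvdE)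
  moreover have "k n < k n * r"
    using k n r by (auto simp: divisibility_sequence_def)
  then have "r \<ge> 2"
    by (cases r; cases "r - 1") auto
  ultimately show thesis
    using that by blast
qed

lemma topspace_adding_machine_space:
  "t \<in> topspace (adding_machine_space k) \<longleftrightarrow>
     t \<in> extensional {1..} \<and> (\<forall>n\<ge>1. t n < k n \<and> t (Suc n) mod k n = t n)"
  by (auto simp: adding_machine_space_def inverse_limit_def cyc_def cyc_proj_def PiE_def Pi_def)

lemma continuous_map_into_adding_machine_space:
  assumes "\<And>x. x \<in> topspace T \<Longrightarrow> f x \<in> topspace (adding_machine_space k)"
    and "\<And>n. n \<ge> 1 \<Longrightarrow> continuous_map T (discrete_topology UNIV) (\<lambda>x. f x n)"
  shows "continuous_map T (adding_machine_space k) f"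
proof -
  have "continuous_map T (discrete_topology (cyc k n)) (\<lambda>x. f x n)" if "n \<ge> 1" for n
  proof -
    have "discrete_topology (cyc k n) = subtopology (discrete_topology UNIV) (cyc k n)"
      by simp
    moreover have "(\<lambda>x. f x n) \<in> topspace T \<rightarrow> cyc k n"
      using assms(1) that by (auto simp: topspace_adding_machine_space cyc_def)
    ultimately show ?thesis
      using assms(2)[OF that] by (simp only: continuous_map_in_subtopology simp_thms)
  qed
  then show ?thesis
    using assms(1) unfolding adding_machine_space_def inverse_limit_def
    by (fastforce simp: continuous_map_in_subtopology continuous_map_componentwise PiE_def)
qed

lemma continuous_map_adding_machine_space_component:
  assumes "n \<ge> 1"
  shows "continuous_map (adding_machine_space k) (discrete_topology UNIV) (\<lambda>t. t n)"
proof -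
  have "continuous_map (adding_machine_space k) (discrete_topology (cyc k n)) (\<lambda>t. t n)"
    unfolding adding_machine_space_def inverse_limit_def
    using assms by (intro continuous_map_from_subtopology continuous_map_product_projection) auto
  moreover have "discrete_topology (cyc k n) = subtopology (discrete_topology UNIV) (cyc k n)"
    by simp
  ultimately show ?thesis
    by (metis continuous_map_into_fulltopology)
qed

lemma Hausdorff_adding_machine_space: "Hausdorff_space (adding_machine_space k)"
  unfolding adding_machine_space_def inverse_limit_def
  by (intro Hausdorff_space_subtopology) (simp add: Hausdorff_space_product_topology)

lemma adding_machine_apply:
  "n \<ge> 1 \<Longrightarrow> adding_machine k t n = (t n + 1) mod k n"
  by (simp add: adding_machine_def inverse_limit_map_def cyc_shift_def)

lemma adding_machine_in_space:
  assumes k: "divisibility_sequence k" and t: "t \<in> topspace (adding_machine_space k)"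
  shows "adding_machine k t \<in> topspace (adding_machine_space k)"
  unfolding topspace_adding_machine_space
proof (intro conjI allI impI)
  show "adding_machine k t \<in> extensional {1..}"
    by (simp add: adding_machine_def inverse_limit_map_def)
  fix n :: nat assume n: "n \<ge> 1"
  show "adding_machine k t n < k n"
    using divisibility_sequence_pos[OF k n] n by (simp add: adding_machine_apply)
  have "k n dvd k (Suc n)"
    using divisibility_sequence_dvd[OF k n] by simp
  then have "adding_machine k t (Suc n) mod k n = (t (Suc n) + 1) mod k n"
    by (simp add: adding_machine_apply mod_mod_cancel)
  also have "\<dots> = (t (Suc n) mod k n + 1) mod k n"
    by (simp add: mod_Suc_eq)
  also have "\<dots> = adding_machine k t n"
    using t n by (simp add: topspace_adding_machine_space adding_machine_apply)
  finally show "adding_machine k t (Suc n) mod k n = adding_machine k t n" .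
qed

lemma continuous_map_adding_machine:
  assumes k: "divisibility_sequence k"
  shows "continuous_map (adding_machine_space k) (adding_machine_space k) (adding_machine k)"
proof (rule continuous_map_into_adding_machine_space)
  show "adding_machine k t \<in> topspace (adding_machine_space k)"
    if "t \<in> topspace (adding_machine_space k)" for t
    using adding_machine_in_space[OF k that] .
  show "continuous_map (adding_machine_space k) (discrete_topology UNIV) (\<lambda>t. adding_machine k t n)"
    if "n \<ge> 1" for n
    using continuous_map_compose[OF continuous_map_adding_machine_space_component[OF that],
        of "discrete_topology UNIV" "\<lambda>i. (i + 1) mod k n"] that
    by (simp add: adding_machine_apply o_def)
qed

text \<open>
  The predecessor is computed in each coordinate by adding \<open>k n - 1\<close>; the results are compatible because
  \<open>k (Suc n) - 1\<close> and \<open>k n - 1\<close> are congruent modulo \<open>k n\<close>.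
\<close>

lemma adding_machine_surj:
  assumes k: "divisibility_sequence k"
  shows "adding_machine k ` topspace (adding_machine_space k) = topspace (adding_machine_space k)"
proof (intro equalityI subsetI)
  fix t assume t: "t \<in> topspace (adding_machine_space k)"
  define s where "s = (\<lambda>n\<in>{1..}. (t n + (k n - 1)) mod k n)"
  have s: "s n = (t n + (k n - 1)) mod k n" if "n \<ge> 1" for n
    using that by (simp add: s_def)
  have "s (Suc n) mod k n = s n" if n: "n \<ge> 1" for n
  proof -
    obtain r where r: "r \<ge> 2" "k (Suc n) = k n * r"
      using divisibility_sequence_mult[OF k n] .
    have "k (Suc n) - 1 = k n * (r - 1) + (k n - 1)"
      using r divisibility_sequence_pos[OF k n] by (cases r) auto
    then have "(t (Suc n) + (k (Suc n) - 1)) mod k n = (t (Suc n) + (k n - 1)) mod k n"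
      by (metis add.left_commute mod_mult_self4 mult.commute add.commute)
    also have "\<dots> = (t (Suc n) mod k n + (k n - 1)) mod k n"
      by (simp add: mod_add_left_eq)
    also have "\<dots> = s n"
      using t n by (simp add: topspace_adding_machine_space s)
    finally show ?thesis
      using r n by (simp add: s mod_mod_cancel)
  qed
  then have "s \<in> topspace (adding_machine_space k)"
    using divisibility_sequence_pos[OF k] s
    unfolding topspace_adding_machine_space by (simp add: s_def)
  moreover have "adding_machine k s = t"
  proof
    fix n
    show "adding_machine k s n = t n"
    proof (cases "n \<ge> 1")
      case True
      then have "adding_machine k s n = (t n + (k n - 1) + 1) mod k n"
        by (simp add: adding_machine_apply s mod_Suc_eq)
      also have "\<dots> = t n"
        using t True divisibility_sequence_pos[OF k True]
        by (simp add: topspace_adding_machine_space)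
      finally show ?thesis .
    next
      case False
      then show ?thesis
        using t by (simp add: topspace_adding_machine_space adding_machine_def
            inverse_limit_map_def extensional_def)
    qed
  qed
  ultimately show "t \<in> adding_machine k ` topspace (adding_machine_space k)"
    by blast
qed (use adding_machine_in_space[OF k] in auto)

text \<open>
  Continuous maps of \<open>U\<close> onto the residues modulo \<open>k n\<close>, compatible with reduction and jointly
  injective. For compact \<open>U\<close> these are the coordinates of a homeomorphism onto the adding machine space.
\<close>

definition residue_tower ::
  "(nat \<Rightarrow> nat) \<Rightarrow> 'a::metric_space set \<Rightarrow> (nat \<Rightarrow> 'a \<Rightarrow> nat) \<Rightarrow> bool" where
  "residue_tower k U c \<longleftrightarrow>
     (\<forall>n\<ge>1. continuous_on UNIV (c n) \<and> c n ` U = {0..<k n} \<and> (\<forall>x\<in>U. c (Suc n) x mod k n = c n x)) \<and>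
     (\<forall>x\<in>U. \<forall>y\<in>U. (\<forall>n\<ge>1. c n x = c n y) \<longrightarrow> x = y)"

text \<open>
  The cardinalities of the partitions are dictated by \<open>k\<close>, so the diameters of their pieces cannot be
  controlled directly. Instead, a countable family of clopen sets \<open>B n\<close> that separates points is fixed,
  and the \<open>n\<close>-th refinement is made to respect \<open>B n\<close>; after all steps every pair of points has been
  separated.
\<close>

lemma residue_tower_exists:
  assumes X: "cantor_space (UNIV :: 'a::metric_space set)" and k: "divisibility_sequence k"
    and U: "open U" "closed U" "(U::'a set) \<noteq> {}"
  shows "\<exists>c. residue_tower k U c"
proof -
  have "\<forall>n. \<exists>q :: 'a \<Rightarrow> nat. continuous_on UNIV q \<and> (\<forall>x y. q x = q y \<longrightarrow> dist x y < 1 / Suc n)"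
  proof
    fix n
    show "\<exists>q :: 'a \<Rightarrow> nat. continuous_on UNIV q \<and> (\<forall>x y. q x = q y \<longrightarrow> dist x y < 1 / Suc n)"
      by (rule fine_colouring[OF X, of "1 / Suc n"]) (simp, blast)
  qed
  then obtain q :: "nat \<Rightarrow> 'a \<Rightarrow> nat" where q: "\<And>n. continuous_on UNIV (q n)"
    and fine: "\<And>n x y. q n x = q n y \<Longrightarrow> dist x y < 1 / Suc n"
    by metis
  \<comment> \<open>The pairs \<open>(n, i)\<close> enumerate all pieces of all the fine partitions \<open>q n\<close>.\<close>
  define B where "B m = {x. q (fst (prod_decode m)) x = snd (prod_decode m)}" for m
  have "\<exists>f. \<forall>n. (continuous_on UNIV (f n) \<and> f n ` U = {0..<k (Suc n)}) \<and>
          ((\<forall>x\<in>U. f (Suc n) x mod k (Suc n) = f n x) \<and>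
           (\<forall>x\<in>U. \<forall>y\<in>U. f (Suc n) x = f (Suc n) y \<longrightarrow> (x \<in> B n \<longleftrightarrow> y \<in> B n)))"
  proof (rule dependent_nat_choice)
    show "\<exists>c :: 'a \<Rightarrow> nat. continuous_on UNIV c \<and> c ` U = {0..<k (Suc 0)}"
      using k U by (intro exI[of _ "\<lambda>_. 0"]) (auto simp: divisibility_sequence_def)
  next
    fix c :: "'a \<Rightarrow> nat" and n
    assume c: "continuous_on UNIV c \<and> c ` U = {0..<k (Suc n)}"
    obtain r where r: "r \<ge> 2" "k (Suc (Suc n)) = k (Suc n) * r"
      using divisibility_sequence_mult[OF k, of "Suc n"] by auto
    have "open (B n)" "closed (B n)"
      unfolding B_def by (auto intro!: clopen_colour q)
    then obtain c' where "continuous_on UNIV c'" "c' ` U = {0..<k (Suc n) * r}"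
      "\<forall>x\<in>U. c' x mod k (Suc n) = c x"
      "\<forall>x\<in>U. \<forall>y\<in>U. c' x = c' y \<longrightarrow> (x \<in> B n \<longleftrightarrow> y \<in> B n)"
      using refine_colouring[OF X r(1) U(1,2), of "B n" c "k (Suc n)"] c by blast
    then show "\<exists>c'. (continuous_on UNIV c' \<and> c' ` U = {0..<k (Suc (Suc n))}) \<and>
        ((\<forall>x\<in>U. c' x mod k (Suc n) = c x) \<and>
         (\<forall>x\<in>U. \<forall>y\<in>U. c' x = c' y \<longrightarrow> (x \<in> B n \<longleftrightarrow> y \<in> B n)))"
      unfolding r(2) by blast
  qed
  then obtain f where f: "\<And>n. continuous_on UNIV (f n)" "\<And>n. f n ` U = {0..<k (Suc n)}"
    "\<And>n x. x \<in> U \<Longrightarrow> f (Suc n) x mod k (Suc n) = f n x"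
    "\<And>n x y. x \<in> U \<Longrightarrow> y \<in> U \<Longrightarrow> f (Suc n) x = f (Suc n) y \<Longrightarrow> x \<in> B n \<longleftrightarrow> y \<in> B n"
    by blast
  have "x = y" if xy: "x \<in> U" "y \<in> U" and eq: "\<forall>n\<ge>1. f (n - 1) x = f (n - 1) y" for x y
  proof (rule ccontr)
    assume "x \<noteq> y"
    then obtain n where n: "1 / Suc n < dist x y"
      using nat_approx_posE[of "dist x y"] by auto
    \<comment> \<open>\<open>B ?m\<close> is the piece of the partition \<open>q n\<close> that contains \<open>x\<close>.\<close>
    let ?m = "prod_encode (n, q n x)"
    have "f (Suc ?m) x = f (Suc ?m) y"
      using eq[rule_format, of "Suc (Suc ?m)"] by simp
    then have "x \<in> B ?m \<longleftrightarrow> y \<in> B ?m"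
      using f(4) xy by blast
    then have "q n x = q n y"
      by (simp add: B_def)
    then show False
      using fine[of n x y] n by simp
  qed
  moreover have "f n x mod k n = f (n - 1) x" if "n \<ge> 1" "x \<in> U" for n x
    using f(3)[OF that(2), of "n - 1"] that by simp
  ultimately have "residue_tower k U (\<lambda>n. f (n - 1))"
    using f(1,2) unfolding residue_tower_def by auto
  then show ?thesis
    by (intro exI[of _ "\<lambda>n. f (n - 1)"])
qed

text \<open>
  Cantor's intersection theorem.
\<close>

lemma compact_decreasing_meet:
  fixes A :: "nat \<Rightarrow> 'a::t2_space set"
  assumes S: "compact S" and A: "\<And>n. closed (A n)" "\<And>n. A (Suc n) \<subseteq> A n" "\<And>n. S \<inter> A n \<noteq> {}"
  shows "\<exists>x\<in>S. \<forall>n. x \<in> A n"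
proof -
  have anti: "A n \<subseteq> A m" if "m \<le> n" for m n
    using lift_Suc_antimono_le[of A, OF A(2) that] .
  have "S \<inter> (\<Inter>n\<in>UNIV. A n) \<noteq> {}"
  proof (rule compact_imp_fip_image[OF S])
    fix I :: "nat set" assume I: "finite I"
    have "S \<inter> A (Max (insert 0 I)) \<subseteq> S \<inter> (\<Inter>n\<in>I. A n)"
    proof -
      have "A (Max (insert 0 I)) \<subseteq> A n" if "n \<in> I" for n
        using I that by (intro anti Max_ge) auto
      then show ?thesis
        by blast
    qed
    then show "S \<inter> (\<Inter>n\<in>I. A n) \<noteq> {}"
      using A(3) by blast
  qed (use A in auto)
  then show ?thesis
    by blast
qed

lemma residue_tower_homeomorphic_map:
  assumes U: "compact U" and c: "residue_tower k U c"
  shows "homeomorphic_map (top_of_set U) (adding_machine_space k) (\<lambda>x. \<lambda>n\<in>{1..}. c n x)"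
    (is "homeomorphic_map _ _ ?f")
proof (rule continuous_imp_homeomorphic_map)
  have cn: "continuous_on UNIV (c n)" "c n ` U = {0..<k n}" if "n \<ge> 1" for n
    using c that by (auto simp: residue_tower_def)
  have step: "c (Suc n) x mod k n = c n x" if "n \<ge> 1" "x \<in> U" for n x
    using c that by (auto simp: residue_tower_def)
  have lt: "c n x < k n" if "n \<ge> 1" "x \<in> U" for n x
    using cn(2)[OF that(1)] that(2) by (metis atLeastLessThan_iff image_eqI)
  have f: "?f x \<in> topspace (adding_machine_space k)" if "x \<in> U" for x
    using that step lt by (auto simp: topspace_adding_machine_space)
  show "continuous_map (top_of_set U) (adding_machine_space k) ?f"
  proof (rule continuous_map_into_adding_machine_space)
    show "continuous_map (top_of_set U) (discrete_topology UNIV) (\<lambda>x. ?f x n)" if "n \<ge> 1" for n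
      using continuous_map_from_subtopology[OF continuous_map_colour[OF cn(1)[OF that]], of U] that
      by simp
  qed (use f in auto)
  show "compact_space (top_of_set U)"
    using U by (simp add: compact_space_subtopology)
  show "Hausdorff_space (adding_machine_space k)"
    by (rule Hausdorff_adding_machine_space)
  show "?f ` topspace (top_of_set U) = topspace (adding_machine_space k)"
  proof (intro equalityI subsetI)
    fix t assume t: "t \<in> topspace (adding_machine_space k)"
    let ?A = "\<lambda>n. U \<inter> {x. c (Suc n) x = t (Suc n)}"
    have "\<exists>x\<in>U. \<forall>n. x \<in> ?A n"
    proof (rule compact_decreasing_meet[OF U])
      fix n
      show "closed (?A n)"
        using compact_imp_closed[OF U] clopen_colour(2)[OF cn(1)[of "Suc n"]] by auto
      show "?A (Suc n) \<subseteq> ?A n"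
      proof
        fix x assume x: "x \<in> ?A (Suc n)"
        then have "c (Suc n) x = t (Suc (Suc n)) mod k (Suc n)"
          using step[of "Suc n" x] by simp
        then show "x \<in> ?A n"
          using t x by (simp add: topspace_adding_machine_space)
      qed
      have "t (Suc n) \<in> c (Suc n) ` U"
        using t cn(2)[of "Suc n"] by (simp add: topspace_adding_machine_space)
      then show "U \<inter> ?A n \<noteq> {}"
        by auto
    qed
    then obtain x where x: "x \<in> U" "\<And>n. c (Suc n) x = t (Suc n)"
      by blast
    have "?f x = t"
    proof
      fix n
      show "?f x n = t n"
        using x(2)[of "n - 1"] t by (auto simp: topspace_adding_machine_space extensional_def)
    qed
    then show "t \<in> ?f ` topspace (top_of_set U)"
      using x(1) by auto
  qed (use f in auto)
  show "inj_on ?f (topspace (top_of_set U))"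
  proof (rule inj_onI)
    fix x y assume xy: "x \<in> topspace (top_of_set U)" "y \<in> topspace (top_of_set U)" "?f x = ?f y"
    have "c n x = c n y" if "n \<ge> 1" for n
      using fun_cong[OF xy(3), of n] that by simp
    then show "x = y"
      using c xy(1,2) by (simp add: residue_tower_def)
  qed
qed

lemma clopen_homeomorphic_adding_machine_space:
  assumes X: "cantor_space (UNIV :: 'a::metric_space set)" and k: "divisibility_sequence k"
    and U: "open U" "closed U" "(U::'a set) \<noteq> {}"
  shows "top_of_set U homeomorphic_space adding_machine_space k"
proof -
  have "compact U"
    using closed_Int_compact[OF U(2) cantor_spaceD(1)[OF X]] by simp
  then show ?thesis
    using residue_tower_exists[OF X k U] residue_tower_homeomorphic_map homeomorphic_map_imp_homeomorphic_space
    by blast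
qed

text \<open>
  Brouwer's uniqueness theorem for the Cantor space, in the form needed to carry a partition into clopen
  sets onto any other partition with the same number of pieces.
\<close>

lemma clopen_homeomorphic_clopen:
  assumes X: "cantor_space (UNIV :: 'a::metric_space set)"
    and "open U" "closed U" "(U::'a set) \<noteq> {}" and "open V" "closed V" "(V::'a set) \<noteq> {}"
  shows "top_of_set U homeomorphic_space top_of_set V"
proof -
  have "divisibility_sequence fact"
    using universal_sequence_fact by (simp add: universal_sequence_def)
  then show ?thesis
    using assms clopen_homeomorphic_adding_machine_space homeomorphic_space_sym homeomorphic_space_trans
    by metis
qed

text \<open>
  Compactness upgrades joint injectivity to uniform smallness: otherwise the closed sets of pairs at
  distance at least \<open>e\<close> with equal colour at stage \<open>n\<close> would decrease to a nonempty set of pairs that no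
  stage separates.
\<close>

lemma residue_tower_mesh:
  assumes U: "compact U" and c: "residue_tower k U c" and e: "e > 0"
  shows "\<exists>n\<ge>1. \<forall>m\<ge>n. \<forall>x\<in>U. \<forall>y\<in>U. c m x = c m y \<longrightarrow> dist x y < e"
proof (rule ccontr)
  assume neg: "\<not> ?thesis"
  have cn: "continuous_on UNIV (c n)" if "n \<ge> 1" for n
    using c that by (auto simp: residue_tower_def)
  have step: "c (Suc n) x mod k n = c n x" if "n \<ge> 1" "x \<in> U" for n x
    using c that by (auto simp: residue_tower_def)
  let ?A = "\<lambda>n. (U \<times> U) \<inter> {p. c (Suc n) (fst p) = c (Suc n) (snd p)} \<inter> {p. e \<le> dist (fst p) (snd p)}"
  have mono: "?A (Suc n) \<subseteq> ?A n" for n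
    using step[of "Suc n"] by (intro subsetI) (auto, metis)
  have "\<exists>p\<in>U \<times> U. \<forall>n. p \<in> ?A n"
  proof (rule compact_decreasing_meet)
    show "compact (U \<times> U)"
      using U by (simp add: compact_Times)
    fix n
    have "continuous_on UNIV (\<lambda>p. c (Suc n) (fst p))" "continuous_on UNIV (\<lambda>p. c (Suc n) (snd p))"
      by (rule continuous_on_compose2[OF cn[of "Suc n"]]; auto intro: continuous_intros)+
    then have "closed {p. c (Suc n) (fst p) = c (Suc n) (snd p)}"
      by (rule closed_Collect_eq)
    moreover have "closed {p :: 'a \<times> 'a. e \<le> dist (fst p) (snd p)}"
      by (intro closed_Collect_le continuous_intros)
    ultimately show "closed (?A n)"
      using compact_imp_closed[OF U] by (auto intro!: closed_Int closed_Times)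
    show "?A (Suc n) \<subseteq> ?A n"
      by (rule mono)
    obtain m x y where m: "m \<ge> Suc n" "x \<in> U" "y \<in> U" "c m x = c m y" "e \<le> dist x y"
    proof -
      have "\<not> (\<forall>m\<ge>Suc n. \<forall>x\<in>U. \<forall>y\<in>U. c m x = c m y \<longrightarrow> dist x y < e)"
        using neg by auto
      then show thesis
        using that by (auto simp: not_less)
    qed
    then have "(x, y) \<in> ?A (m - 1)"
      by simp
    also have "?A (m - 1) \<subseteq> ?A n"
      by (rule lift_Suc_antimono_le[of ?A, OF mono]) (use m(1) in simp)
    finally show "(U \<times> U) \<inter> ?A n \<noteq> {}"
      by blast
  qed
  then obtain x y where xy: "x \<in> U" "y \<in> U" "\<And>n. c (Suc n) x = c (Suc n) y" "e \<le> dist x y"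
    by auto
  have "c n x = c n y" if "n \<ge> 1" for n
    using xy(3)[of "n - 1"] that by simp
  then have "x = y"
    using c xy(1,2) unfolding residue_tower_def by blast
  then show False
    using xy(4) e by simp
qed

section \<open>Transport of maps and conjugacy\<close>

lemma continuous_on_imp_bcontfun:
  fixes f :: "'a::metric_space \<Rightarrow> 'a"
  assumes "compact (UNIV :: 'a set)" and "continuous_on UNIV f"
  shows "\<exists>F :: 'a \<Rightarrow>\<^sub>C 'a. apply_bcontfun F = f"
proof -
  have "f \<in> bcontfun"
    using assms compact_imp_bounded[OF compact_continuous_image[OF assms(2,1)]] by (simp add: bcontfun_def)
  then show ?thesis
    using Bcontfun_inverse by blast
qed

lemma homeomorphic_maps_euclidean_iff:
  "homeomorphic_maps euclidean euclidean h h' \<longleftrightarrow> homeomorphism UNIV UNIV h h'"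
proof
  assume "homeomorphic_maps euclidean euclidean h h'"
  then show "homeomorphism UNIV UNIV h h'"
    unfolding homeomorphic_maps_def homeomorphism_def by (auto simp: surj_def) metis+
qed (auto simp: homeomorphic_maps_def homeomorphism_def)

text \<open>
  A surjective continuous system on any space homeomorphic to the Cantor space has a copy in \<open>Cs\<close>.
\<close>

lemma isomorphic_to_exists:
  fixes h :: "'b \<Rightarrow> 'a::metric_space"
  assumes X: "compact (UNIV :: 'a set)" and h: "homeomorphic_map T euclidean h"
    and f: "continuous_map T T f" "f ` topspace T = topspace T"
  shows "\<exists>F :: 'a \<Rightarrow>\<^sub>C 'a. F \<in> Cs \<and> isomorphic_to F T f"
proof -
  obtain g where "homeomorphic_maps T euclidean h g"
    using h by (auto simp: homeomorphic_map_maps)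
  then have g: "continuous_map T euclidean h" "continuous_map euclidean T g"
    "\<And>x. x \<in> topspace T \<Longrightarrow> g (h x) = x" "\<And>y. h (g y) = y"
    by (auto simp: homeomorphic_maps_def)
  have gT: "g y \<in> topspace T" for y
    using continuous_map_image_subset_topspace[OF g(2)] by auto
  have "continuous_map euclidean euclidean (h \<circ> f \<circ> g)"
    using continuous_map_compose[OF g(2) continuous_map_compose[OF f(1) g(1)]] by (simp add: o_assoc)
  then obtain F :: "'a \<Rightarrow>\<^sub>C 'a" where F: "apply_bcontfun F = h \<circ> f \<circ> g"
    using continuous_on_imp_bcontfun[OF X, of "h \<circ> f \<circ> g"] by auto
  have "surj (h \<circ> f \<circ> g)"
    unfolding surj_def
  proof
    fix y
    obtain x where "x \<in> topspace T" "f x = g y"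
      using f(2) gT[of y] by (metis imageE)
    then have "(h \<circ> f \<circ> g) (h x) = y"
      using g(3,4) by simp
    then show "\<exists>z. y = (h \<circ> f \<circ> g) z"
      by metis
  qed
  then have "F \<in> Cs"
    by (simp add: Cs_def F)
  moreover have "isomorphic_to F T f"
    using h g(3) by (auto simp: isomorphic_to_def F)
  ultimately show ?thesis
    by blast
qed

text \<open>
  Once a single copy of a system is known, its conjugacy class consists of all copies.
\<close>

lemma conj_class_iff_isomorphic_to:
  assumes F: "isomorphic_to F T f" and G: "G \<in> Cs" and f: "f ` topspace T \<subseteq> topspace T"
  shows "G \<in> conj_class F \<longleftrightarrow> isomorphic_to G T f"
proof -
  obtain h where h: "homeomorphic_map T euclidean h" "\<And>x. x \<in> topspace T \<Longrightarrow> h (f x) = F (h x)"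
    using F by (auto simp: isomorphic_to_def)
  then obtain g where hg: "homeomorphic_maps T euclidean h g"
    by (auto simp: homeomorphic_map_maps)
  have gT: "g y \<in> topspace T" "h (g y) = y" for y
    using hg by (auto simp: homeomorphic_maps_def continuous_map_def Pi_iff)
  show ?thesis
  proof
    assume "G \<in> conj_class F"
    then obtain a a' where a: "homeomorphism UNIV UNIV a a'" "apply_bcontfun G = a \<circ> apply_bcontfun F \<circ> a'"
      by (auto simp: conj_class_def)
    have "homeomorphic_map euclidean euclidean a"
      using a(1) by (auto simp: homeomorphic_map_maps homeomorphic_maps_euclidean_iff)
    then have "homeomorphic_map T euclidean (a \<circ> h)"
      using h(1) homeomorphic_map_compose by blast
    moreover have "a' (a x) = x" for x
      using a(1) by (simp add: homeomorphism_def)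
    ultimately show "isomorphic_to G T f"
      using h(2) by (auto simp: isomorphic_to_def a(2) intro!: exI[of _ "a \<circ> h"])
  next
    assume "isomorphic_to G T f"
    then obtain b where b: "homeomorphic_map T euclidean b" "\<And>x. x \<in> topspace T \<Longrightarrow> b (f x) = G (b x)"
      by (auto simp: isomorphic_to_def)
    then obtain b' where bb: "homeomorphic_maps T euclidean b b'"
      by (auto simp: homeomorphic_map_maps)
    have bT: "b' y \<in> topspace T" "b (b' y) = y" for y
      using bb by (auto simp: homeomorphic_maps_def continuous_map_def Pi_iff)
    have "homeomorphic_maps euclidean euclidean (b \<circ> g) (h \<circ> b')"
      using homeomorphic_maps_compose[OF conjI[OF iffD1[OF homeomorphic_maps_sym hg] bb]] .
    moreover have "G y = ((b \<circ> g) \<circ> apply_bcontfun F \<circ> (h \<circ> b')) y" for y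
    proof -
      have "g (h (f (b' y))) = f (b' y)"
        using hg bT(1)[of y] f by (auto simp: homeomorphic_maps_def)
      then show ?thesis
        using h(2)[OF bT(1)[of y]] b(2)[OF bT(1)[of y]] bT(2)[of y] by simp
    qed
    ultimately show "G \<in> conj_class F"
      using G unfolding conj_class_def homeomorphic_maps_euclidean_iff
      by (intro CollectI conjI exI[of _ "b \<circ> g"] exI[of _ "h \<circ> b'"] ext) auto
  qed
qed

section \<open>Cyclic factors\<close>

text \<open>
  A factor map onto the rotation of \<open>\<int>/L\<int>\<close>, that is, a partition into \<open>L\<close> clopen sets that the map permutes
  cyclically.
\<close>

definition cyclic_factor :: "('a::topological_space \<Rightarrow> 'a) \<Rightarrow> nat \<Rightarrow> ('a \<Rightarrow> nat) \<Rightarrow> bool" where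
  "cyclic_factor f L c \<longleftrightarrow>
     0 < L \<and> continuous_on UNIV c \<and> (\<forall>x. c x < L \<and> c (f x) = (c x + 1) mod L)"

lemma cyclic_factor_iterate:
  assumes "cyclic_factor f L c"
  shows "c ((f ^^ n) x) = (c x + n) mod L"
  using assms by (induction n) (auto simp: cyclic_factor_def mod_Suc_eq)

lemma cyclic_factor_hits:
  assumes c: "cyclic_factor f L c" and i: "i < L"
  obtains n where "n \<ge> 1" "c ((f ^^ n) x) = i"
proof -
  have "c x < L"
    using c by (simp add: cyclic_factor_def)
  then have "c ((f ^^ (i + L - c x)) x) = i"
    using i by (simp add: cyclic_factor_iterate[OF c])
  then show thesis
    using that[of "i + L - c x"] \<open>c x < L\<close> by simp
qed

lemma cyclic_factor_dvd:
  assumes c: "cyclic_factor f L c" and M: "M dvd L"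
  shows "cyclic_factor f M (\<lambda>x. c x mod M)"
proof -
  have "0 < M"
    using c M by (auto simp: cyclic_factor_def intro: gr0I)
  then show ?thesis
    using c M continuous_on_nat_comp[of c "\<lambda>i. i mod M"]
    by (auto simp: cyclic_factor_def mod_mod_cancel mod_Suc_eq)
qed

text \<open>
  Subtracting \<open>c z\<close> in \<open>\<int>/L\<int>\<close> moves the piece of the base point \<open>z\<close> to residue \<open>0\<close> and keeps the
  partition.
\<close>

lemma cyclic_factor_normalised:
  assumes c: "cyclic_factor f L c"
  shows "cyclic_factor f L (\<lambda>x. (c x + (L - c z)) mod L)"
    and "(c z + (L - c z)) mod L = 0"
    and "(c x + (L - c z)) mod L = (c y + (L - c z)) mod L \<Longrightarrow> c x = c y"
proof -
  show "cyclic_factor f L (\<lambda>x. (c x + (L - c z)) mod L)"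
    using c continuous_on_nat_comp[of c "\<lambda>i. (i + (L - c z)) mod L"]
    by (auto simp: cyclic_factor_def mod_simps add.commute add.left_commute)
  show "(c z + (L - c z)) mod L = 0"
    using c by (simp add: cyclic_factor_def less_imp_le)
  assume "(c x + (L - c z)) mod L = (c y + (L - c z)) mod L"
  then have "c x mod L = c y mod L"
    by (simp add: nat_mod_eq_iff)
  then show "c x = c y"
    using c by (simp add: cyclic_factor_def)
qed

text \<open>
  An orbit visits all pieces of a cyclic factor, and the pieces can be taken arbitrarily small.
\<close>

lemma fine_cyclic_factors_dense_orbit:
  assumes fine: "\<And>e. e > 0 \<Longrightarrow> \<exists>L c. cyclic_factor f L c \<and> (\<forall>x y. c x = c y \<longrightarrow> dist x y < e)"
  shows "closure (range (\<lambda>n. (f ^^ n) z)) = (UNIV :: 'a::metric_space set)"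
proof -
  have "\<exists>n. dist ((f ^^ n) z) x < e" if e: "e > 0" for x e
  proof -
    obtain L c where c: "cyclic_factor f L c" "\<And>x y. c x = c y \<Longrightarrow> dist x y < e"
      using fine[OF e] by blast
    have "c x < L"
      using c(1) by (simp add: cyclic_factor_def)
    then show ?thesis
      using cyclic_factor_hits[OF c(1), of "c x" z] c(2) by metis
  qed
  then show ?thesis
    by (auto simp: closure_approachable)
qed

text \<open>
  Along an orbit a cyclic factor is determined by its initial value, and continuity extends the agreement
  to the closure of the orbit. It is this rigidity that makes cyclic factors of different lengths
  compatible once they are normalised at the same base point.
\<close>

lemma cyclic_factor_unique:
  assumes dense: "closure (range (\<lambda>n. (f ^^ n) z)) = (UNIV :: 'a::metric_space set)"
    and c: "cyclic_factor f L c" "cyclic_factor f L d" and z: "c z = d z"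
  shows "c = d"
proof
  fix x
  have "closed {x. c x = d x}"
    using c by (intro closed_Collect_eq) (auto simp: cyclic_factor_def)
  moreover have "range (\<lambda>n. (f ^^ n) z) \<subseteq> {x. c x = d x}"
    using z by (auto simp: cyclic_factor_iterate[OF c(1)] cyclic_factor_iterate[OF c(2)])
  ultimately have "closure (range (\<lambda>n. (f ^^ n) z)) \<subseteq> {x. c x = d x}"
    by (rule closure_minimal[rotated])
  then show "c x = d x"
    using dense by auto
qed

section \<open>The conjugacy class of an adding machine\<close>

lemma isomorphic_to_adding_machine_iff:
  fixes F :: "'a::metric_space \<Rightarrow>\<^sub>C 'a"
  assumes X: "compact (UNIV :: 'a set)" and k: "divisibility_sequence k"
  shows "isomorphic_to F (adding_machine_space k) (adding_machine k) \<longleftrightarrow>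
     (\<exists>c. residue_tower k UNIV c \<and> (\<forall>n\<ge>1. cyclic_factor (apply_bcontfun F) (k n) (c n)))"
proof
  assume "isomorphic_to F (adding_machine_space k) (adding_machine k)"
  then obtain h where h: "homeomorphic_map (adding_machine_space k) euclidean h"
    "\<And>t. t \<in> topspace (adding_machine_space k) \<Longrightarrow> h (adding_machine k t) = F (h t)"
    by (auto simp: isomorphic_to_def)
  then obtain g where "homeomorphic_maps (adding_machine_space k) euclidean h g"
    by (auto simp: homeomorphic_map_maps)
  then have g: "continuous_map euclidean (adding_machine_space k) g"
    "\<And>t. t \<in> topspace (adding_machine_space k) \<Longrightarrow> g (h t) = t" "\<And>x. h (g x) = x"
    by (auto simp: homeomorphic_maps_def)
  have gT: "g x \<in> topspace (adding_machine_space k)" for x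
    using continuous_map_image_subset_topspace[OF g(1)] by auto
  have gF: "g (F x) = adding_machine k (g x)" for x
    using h(2)[OF gT[of x]] g(2)[OF adding_machine_in_space[OF k gT[of x]]] g(3)[of x] by metis
  have "g x n < k n \<and> g x (Suc n) mod k n = g x n" if "n \<ge> 1" for n x
    using gT[of x] that by (simp add: topspace_adding_machine_space)
  moreover have cont: "continuous_on UNIV (\<lambda>x. g x n)" if "n \<ge> 1" for n
    using continuous_map_compose[OF g(1) continuous_map_adding_machine_space_component[OF that]]
    by (simp add: o_def continuous_map_nat_iff)
  moreover have "i \<in> range (\<lambda>x. g x n)" if n: "n \<ge> 1" and i: "i < k n" for n i
  proof -
    \<comment> \<open>Every residue occurs as a coordinate: the integer \<open>i\<close> is itself a point of the inverse limit.\<close>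
    let ?t = "\<lambda>m\<in>{1..}. i mod k m"
    have "?t \<in> topspace (adding_machine_space k)"
      using divisibility_sequence_pos[OF k] divisibility_sequence_dvd[OF k]
      by (auto simp: topspace_adding_machine_space mod_mod_cancel)
    then have "g (h ?t) n = i"
      using g(2)[of ?t] n i by simp
    then show ?thesis
      by (intro image_eqI[of _ _ "h ?t"]) auto
  qed
  moreover have "x = y" if "\<forall>n\<ge>1. g x n = g y n" for x y
  proof -
    have "g x = g y"
      using that gT[of x] gT[of y]
      by (intro ext) (metis atLeast_iff extensional_arb topspace_adding_machine_space)
    then show ?thesis
      using g(3) by metis
  qed
  moreover have "cyclic_factor (apply_bcontfun F) (k n) (\<lambda>x. g x n)" if "n \<ge> 1" for n
    using divisibility_sequence_pos[OF k that] cont[OF that] gT that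
    by (auto simp: cyclic_factor_def gF adding_machine_apply topspace_adding_machine_space)
  ultimately show "\<exists>c. residue_tower k UNIV c \<and> (\<forall>n\<ge>1. cyclic_factor (apply_bcontfun F) (k n) (c n))"
    by (intro exI[of _ "\<lambda>n x. g x n"]) (auto simp: residue_tower_def)
next
  assume "\<exists>c. residue_tower k UNIV c \<and> (\<forall>n\<ge>1. cyclic_factor (apply_bcontfun F) (k n) (c n))"
  then obtain c where c: "residue_tower k UNIV c" "\<And>n. n \<ge> 1 \<Longrightarrow> cyclic_factor (apply_bcontfun F) (k n) (c n)"
    by blast
  let ?g = "\<lambda>x. \<lambda>n\<in>{1..}. c n x"
  have "homeomorphic_map euclidean (adding_machine_space k) ?g"
    using residue_tower_homeomorphic_map[OF X c(1)] by simp
  then obtain h where h: "homeomorphic_maps euclidean (adding_machine_space k) ?g h"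
    by (auto simp: homeomorphic_map_maps)
  then have hh: "homeomorphic_map (adding_machine_space k) euclidean h"
    using homeomorphic_maps_sym homeomorphic_map_maps by blast
  have gF: "?g (F x) = adding_machine k (?g x)" for x
  proof
    fix n
    show "?g (F x) n = adding_machine k (?g x) n"
      using c(2)[of n] by (auto simp: adding_machine_def inverse_limit_map_def cyc_shift_def cyclic_factor_def)
  qed
  have gh: "?g (h t) = t" if "t \<in> topspace (adding_machine_space k)" for t
    using h that unfolding homeomorphic_maps_def by blast
  have hg: "h (?g x) = x" for x
    using h unfolding homeomorphic_maps_def by simp
  have "h (adding_machine k t) = F (h t)" if "t \<in> topspace (adding_machine_space k)" for t
    using gF[of "h t"] gh[OF that] hg[of "F (h t)"] by simp
  then show "isomorphic_to F (adding_machine_space k) (adding_machine k)"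
    using hh by (auto simp: isomorphic_to_def)
qed

text \<open>
  The pieces are bounded by \<open>1 / (j + 1)\<close> and the length comes late in the sequence, so that belonging to
  all these sets provides cyclic factors whose lengths are divisible by every \<open>k n\<close>.
\<close>

definition fine_cyclic_maps :: "(nat \<Rightarrow> nat) \<Rightarrow> nat \<Rightarrow> ('a::metric_space \<Rightarrow>\<^sub>C 'a) set" where
  "fine_cyclic_maps k j =
     {F \<in> Cs. \<exists>m>j. \<exists>c. cyclic_factor (apply_bcontfun F) (k m) c \<and> (\<forall>x y. c x = c y \<longrightarrow> dist x y < 1 / real (Suc j))}"

text \<open>
  A map is a copy of the adding machine exactly when it has small cyclic factors of lengths in the
  sequence. No compatibility between these factors is demanded: after normalisation at a base point it
  follows from \<open>cyclic_factor_unique\<close>. This turns conjugacy to the adding machine into countably many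
  conditions, each of them concerning a single finite partition.
\<close>

lemma isomorphic_to_adding_machine_iff_fine_cyclic_maps:
  fixes F :: "'a::metric_space \<Rightarrow>\<^sub>C 'a"
  assumes X: "compact (UNIV :: 'a set)" and k: "divisibility_sequence k"
  shows "F \<in> Cs \<and> isomorphic_to F (adding_machine_space k) (adding_machine k) \<longleftrightarrow>
     F \<in> (\<Inter>j. fine_cyclic_maps k j)"
proof
  assume F: "F \<in> Cs \<and> isomorphic_to F (adding_machine_space k) (adding_machine k)"
  then obtain c where c: "residue_tower k UNIV c" "\<And>n. n \<ge> 1 \<Longrightarrow> cyclic_factor (apply_bcontfun F) (k n) (c n)"
    using isomorphic_to_adding_machine_iff[OF X k] by blast
  have "\<exists>m>j. \<exists>c. cyclic_factor (apply_bcontfun F) (k m) c \<and> (\<forall>x y. c x = c y \<longrightarrow> dist x y < 1 / real (Suc j))" for j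
  proof -
    obtain n where n: "n \<ge> 1" "\<And>m x y. m \<ge> n \<Longrightarrow> c m x = c m y \<Longrightarrow> dist x y < 1 / real (Suc j)"
      using residue_tower_mesh[OF X c(1), of "1 / real (Suc j)"] by auto
    \<comment> \<open>The stage has to be both fine enough and late enough in the sequence.\<close>
    have "max n (Suc j) > j" "max n (Suc j) \<ge> 1" "max n (Suc j) \<ge> n"
      by auto
    then show ?thesis
      using n(2) c(2) by meson
  qed
  then show "F \<in> (\<Inter>j. fine_cyclic_maps k j)"
    using F by (auto simp: fine_cyclic_maps_def)
next
  assume "F \<in> (\<Inter>j. fine_cyclic_maps k j)"
  then have F: "F \<in> Cs"
    and "\<forall>j. \<exists>m>j. \<exists>c. cyclic_factor (apply_bcontfun F) (k m) c \<and> (\<forall>x y. c x = c y \<longrightarrow> dist x y < 1 / real (Suc j))"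
    by (auto simp: fine_cyclic_maps_def)
  then obtain m b where mb: "\<And>j. m j > j" "\<And>j. cyclic_factor (apply_bcontfun F) (k (m j)) (b j)"
    "\<And>j x y. b j x = b j y \<Longrightarrow> dist x y < 1 / real (Suc j)"
    by metis
  fix z :: 'a
  define d where "d j x = (b j x + (k (m j) - b j z)) mod k (m j)" for j x
  have d: "cyclic_factor (apply_bcontfun F) (k (m j)) (d j)" "d j z = 0" for j
    unfolding d_def using cyclic_factor_normalised(1,2)[OF mb(2)] by auto
  have dd: "dist x y < 1 / real (Suc j)" if "d j x = d j y" for j x y
    using that cyclic_factor_normalised(3)[OF mb(2)[of j]] mb(3) unfolding d_def by blast
  have dense: "closure (range (\<lambda>n. (apply_bcontfun F ^^ n) z)) = UNIV"
  proof (rule fine_cyclic_factors_dense_orbit)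
    fix e :: real assume "e > 0"
    then obtain j where "1 / real (Suc j) < e"
      using nat_approx_posE by blast
    then show "\<exists>L c. cyclic_factor (apply_bcontfun F) L c \<and> (\<forall>x y. c x = c y \<longrightarrow> dist x y < e)"
      using mb(2)[of j] mb(3)[of j] by (meson order_less_trans)
  qed
  define c where "c n x = d n x mod k n" for n x
  have kdvd: "k n dvd k (m j)" if "n \<ge> 1" "n \<le> m j" for n j
    using divisibility_sequence_dvd[OF k that] .
  have c: "cyclic_factor (apply_bcontfun F) (k n) (c n)" if "n \<ge> 1" for n
    unfolding c_def using cyclic_factor_dvd[OF d(1) kdvd[OF that]] mb(1)[of n] by auto
  have cz: "c n z = 0" for n
    by (simp add: c_def d(2))
  \<comment> \<open>The reduction of a later factor recovers \<open>d j\<close>, so the pieces of \<open>c\<close> are as small as those of \<open>d\<close>.\<close>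
  have cd: "c (m j) = d j" for j
    using mb(1)[of j] by (intro cyclic_factor_unique[OF dense c d(1)]) (auto simp: cz d(2))
  have "residue_tower k UNIV c"
    unfolding residue_tower_def
  proof (intro conjI allI impI ballI)
    fix n :: nat assume n: "n \<ge> 1"
    show "continuous_on UNIV (c n)"
      using c[OF n] by (simp add: cyclic_factor_def)
    show "range (c n) = {0..<k n}"
    proof (intro equalityI subsetI)
      fix i assume "i \<in> {0..<k n}"
      then show "i \<in> range (c n)"
        using cyclic_factor_hits[OF c[OF n], of i z] by (metis atLeastLessThan_iff rangeI)
    qed (use c[OF n] in \<open>auto simp: cyclic_factor_def\<close>)
    fix x
    have "k n dvd k (Suc n)"
      using divisibility_sequence_dvd[OF k n] by simp
    then have "(\<lambda>x. c (Suc n) x mod k n) = c n"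
      using n by (intro cyclic_factor_unique[OF dense cyclic_factor_dvd[OF c] c]) (auto simp: cz)
    then show "c (Suc n) x mod k n = c n x"
      by (rule fun_cong)
  next
    fix x y assume eq: "\<forall>n\<ge>1. c n x = c n y"
    show "x = y"
    proof (rule ccontr)
      assume "x \<noteq> y"
      then obtain j where j: "1 / real (Suc j) < dist x y"
        using nat_approx_posE[of "dist x y"] by auto
      have "c (m j) x = c (m j) y"
        using eq mb(1)[of j] by simp
      then show False
        using dd[of j x y] j by (simp add: cd)
    qed
  qed
  then show "F \<in> Cs \<and> isomorphic_to F (adding_machine_space k) (adding_machine k)"
    using F c isomorphic_to_adding_machine_iff[OF X k] by blast
qed

text \<open>
  The same partition serves for all nearby maps, because they move each point into the same piece.
\<close>

lemma open_fine_cyclic_maps: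
  assumes X: "compact (UNIV :: 'a::metric_space set)"
  shows "openin (top_of_set (Cs :: ('a \<Rightarrow>\<^sub>C 'a) set)) (fine_cyclic_maps k j)"
  unfolding openin_euclidean_subtopology_iff
proof (intro conjI ballI)
  fix F :: "'a \<Rightarrow>\<^sub>C 'a" assume "F \<in> fine_cyclic_maps k j"
  then obtain m c where F: "F \<in> Cs" "m > j" "cyclic_factor (apply_bcontfun F) (k m) c"
    "\<forall>x y. c x = c y \<longrightarrow> dist x y < 1 / real (Suc j)"
    by (auto simp: fine_cyclic_maps_def)
  then obtain \<delta> where \<delta>: "\<delta> > 0" "\<And>x y. dist x y < \<delta> \<Longrightarrow> c x = c y"
    using uniform_colour[OF X, of c] unfolding cyclic_factor_def by metis
  have "G \<in> fine_cyclic_maps k j" if G: "G \<in> Cs" "dist G F < \<delta>" for G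
  proof -
    have "c (G x) = c (F x)" for x
      using \<delta>(2) dist_fun_lt_imp_dist_val_lt[OF G(2)] by blast
    then have "cyclic_factor (apply_bcontfun G) (k m) c"
      using F(3) by (simp add: cyclic_factor_def)
    then show ?thesis
      using G F by (auto simp: fine_cyclic_maps_def)
  qed
  then show "\<exists>e>0. \<forall>G\<in>Cs. dist G F < e \<longrightarrow> G \<in> fine_cyclic_maps k j"
    using \<delta>(1) by blast
qed (auto simp: fine_cyclic_maps_def)

lemma adding_machine_residual_type:
  fixes F :: "'a::metric_space \<Rightarrow>\<^sub>C 'a"
  assumes X: "compact (UNIV :: 'a set)" and k: "divisibility_sequence k"
    and F: "F \<in> Cs" "isomorphic_to F (adding_machine_space k) (adding_machine k)"
  shows "residual_type F"
proof -
  have "G \<in> conj_class F \<longleftrightarrow> G \<in> (\<Inter>j. fine_cyclic_maps k j)" for G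
    using conj_class_iff_isomorphic_to[OF F(2), of G] adding_machine_in_space[OF k]
      isomorphic_to_adding_machine_iff_fine_cyclic_maps[OF X k, of G]
    by (auto simp: conj_class_def image_subset_iff)
  then have "conj_class F = (\<Inter>j. fine_cyclic_maps k j)"
    by blast
  moreover have "gdelta_in (top_of_set Cs) (\<Inter>(range (fine_cyclic_maps k) :: ('a \<Rightarrow>\<^sub>C 'a) set set))"
    by (intro gdelta_in_Inter) (auto intro: open_imp_gdelta_in open_fine_cyclic_maps[OF X])
  ultimately show ?thesis
    using F(1) by (simp add: residual_type_def)
qed

section \<open>Chain transitivity\<close>

text \<open>
  Chains are the paths of the relation \<open>dist (f a) b < e\<close>, so concatenating them is transitivity.
\<close>

lemma chain_transitive_iff_tranclp:
  "chain_transitive f \<longleftrightarrow> (\<forall>e>0. \<forall>x y. (\<lambda>a b. dist (f a) b < e)\<^sup>+\<^sup>+ x y)"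
  unfolding chain_transitive_def tranclp_power relpowp_fun_conv
  by (simp add: Suc_le_eq)

lemma tranclp_image:
  assumes "R\<^sup>+\<^sup>+ x y" and "\<And>a b. R a b \<Longrightarrow> S\<^sup>+\<^sup>+ (h a) (h b)"
  shows "S\<^sup>+\<^sup>+ (h x) (h y)"
  using assms(1)
proof (induction rule: tranclp_induct)
  case (base y)
  then show ?case
    by (rule assms(2))
next
  case (step y z)
  then show ?case
    using assms(2) by (meson tranclp_trans)
qed

lemma chain_transitive_factor:
  fixes h :: "'a::metric_space \<Rightarrow> 'b::metric_space"
  assumes f: "chain_transitive f" and h: "uniformly_continuous_on UNIV h" "surj h"
    and fg: "\<And>x. h (f x) = g (h x)"
  shows "chain_transitive g"
  unfolding chain_transitive_iff_tranclp
proof (intro allI impI)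
  fix e :: real and x y :: 'b assume "e > 0"
  then obtain \<delta> where \<delta>: "\<delta> > 0" "\<And>x y. dist x y < \<delta> \<Longrightarrow> dist (h x) (h y) < e"
    using h(1) unfolding uniformly_continuous_on_def by (metis UNIV_I)
  obtain a b where ab: "x = h a" "y = h b"
    using h(2) by (metis surjD)
  have "(\<lambda>a b. dist (f a) b < \<delta>)\<^sup>+\<^sup>+ a b"
    using f \<delta>(1) by (simp add: chain_transitive_iff_tranclp)
  then show "(\<lambda>a b. dist (g a) b < e)\<^sup>+\<^sup>+ x y"
    unfolding ab
  proof (rule tranclp_image)
    fix a b assume "dist (f a) b < \<delta>"
    then show "(\<lambda>a b. dist (g a) b < e)\<^sup>+\<^sup>+ (h a) (h b)"
      using \<delta>(2)[of "f a" b] fg by (intro tranclp.r_into_trancl) simp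
  qed
qed

lemma closure_of_Cs_iff:
  assumes "S \<subseteq> Cs"
  shows "f \<in> (top_of_set Cs) closure_of S \<longleftrightarrow> f \<in> Cs \<and> (\<forall>e>0. \<exists>g\<in>S. dist g f < e)"
  using assms by (simp add: closure_of_subtopology inf.absorb2 closure_approachable)

lemma closedin_CT: "closedin (top_of_set Cs) (CT :: ('a::metric_space \<Rightarrow>\<^sub>C 'a) set)"
  unfolding closure_of_eq[symmetric]
proof (intro equalityI subsetI)
  fix f :: "'a \<Rightarrow>\<^sub>C 'a" assume "f \<in> (top_of_set Cs) closure_of CT"
  then have f: "f \<in> Cs" "\<And>e. e > 0 \<Longrightarrow> \<exists>g\<in>CT. dist g f < e"
    by (auto simp: closure_of_Cs_iff CT_def)
  have "(\<lambda>a b. dist (f a) b < e)\<^sup>+\<^sup>+ x y" if e: "e > 0" for e x y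
  proof -
    obtain g where g: "g \<in> CT" "dist g f < e / 2"
      using f(2)[of "e / 2"] e by auto
    have "(\<lambda>a b. dist (g a) b < e / 2)\<^sup>+\<^sup>+ x y"
      using g(1) half_gt_zero[OF e] unfolding CT_def chain_transitive_iff_tranclp by blast
    then show ?thesis
    proof (rule tranclp_image[where h = "\<lambda>x. x"])
      fix a b assume "dist (g a) b < e / 2"
      moreover have "dist (g a) (f a) < e / 2"
        using g(2) by (rule dist_fun_lt_imp_dist_val_lt)
      ultimately have "dist (f a) b < e"
        using dist_triangle3[of "f a" b "g a"] by linarith
      then show "(\<lambda>a b. dist (f a) b < e)\<^sup>+\<^sup>+ a b"
        by (rule tranclp.r_into_trancl)
    qed
  qed
  then show "f \<in> CT"
    using f(1) unfolding CT_def chain_transitive_iff_tranclp by blast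
qed (use closure_of_subset[of CT "top_of_set Cs"] in \<open>auto simp: CT_def\<close>)

lemma conj_class_subset_CT:
  assumes X: "compact (UNIV :: 'a::metric_space set)" and f: "(f :: 'a \<Rightarrow>\<^sub>C 'a) \<in> CT"
  shows "conj_class f \<subseteq> CT"
proof
  fix g assume "g \<in> conj_class f"
  then obtain h h' where g: "g \<in> Cs" and h: "homeomorphism UNIV UNIV h h'"
    and gh: "apply_bcontfun g = h \<circ> apply_bcontfun f \<circ> h'"
    by (auto simp: conj_class_def)
  have "chain_transitive (apply_bcontfun g)"
  proof (rule chain_transitive_factor)
    show "chain_transitive (apply_bcontfun f)"
      using f by (simp add: CT_def)
    show "uniformly_continuous_on UNIV h" "surj h"
      using h compact_uniformly_continuous[OF _ X] by (auto simp: homeomorphism_def)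
    show "h (f x) = g (h x)" for x
      using h by (simp add: gh homeomorphism_def)
  qed
  then show "g \<in> CT"
    using g by (simp add: CT_def)
qed

text \<open>
  A true orbit leads from \<open>x\<close> to the small piece that contains \<open>y\<close>; only its last point has to be
  replaced by \<open>y\<close>.
\<close>

lemma chain_transitive_fine_cyclic_factors:
  fixes f :: "'a::metric_space \<Rightarrow> 'a"
  assumes fine: "\<And>e. e > 0 \<Longrightarrow> \<exists>L c. cyclic_factor f L c \<and> (\<forall>x y. c x = c y \<longrightarrow> dist x y < e)"
  shows "chain_transitive f"
  unfolding chain_transitive_iff_tranclp
proof (intro allI impI)
  fix e :: real and x y assume e: "e > 0"
  obtain L c where c: "cyclic_factor f L c" "\<And>x y. c x = c y \<Longrightarrow> dist x y < e"
    using fine[OF e] by blast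
  have "c y < L"
    using c(1) by (simp add: cyclic_factor_def)
  then obtain n where n: "n \<ge> 1" "c ((f ^^ n) x) = c y"
    using cyclic_factor_hits[OF c(1)] by metis
  let ?R = "\<lambda>a b. dist (f a) b < e"
  have orbit: "?R\<^sup>*\<^sup>* x ((f ^^ m) x)" for m
  proof (induction m)
    case (Suc m)
    have "?R ((f ^^ m) x) ((f ^^ Suc m) x)"
      using e by simp
    then show ?case
      using Suc.IH by (meson rtranclp.rtrancl_into_rtrancl)
  qed simp
  have "(f ^^ n) x = f ((f ^^ (n - 1)) x)"
    using n(1) by (cases n) auto
  then have "?R ((f ^^ (n - 1)) x) y"
    using c(2)[OF n(2)] by simp
  then show "?R\<^sup>+\<^sup>+ x y"
    using orbit[of "n - 1"] by (meson rtranclp_into_tranclp1)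
qed

lemma chain_concat:
  assumes c: "c 0 = x" "c m = y" "\<And>i. i < m \<Longrightarrow> R (c i) (c (Suc i))"
    and d: "d 0 = y" "d n = z" "\<And>i. i < n \<Longrightarrow> R (d i) (d (Suc i))"
  obtains w :: "nat \<Rightarrow> 'a" where "w 0 = x" "w (m + n) = z" "\<And>i. i < m + n \<Longrightarrow> R (w i) (w (Suc i))"
    "c ` {..<m} \<union> d ` {..<n} \<subseteq> w ` {..<m + n}"
proof -
  let ?w = "\<lambda>i. if i < m then c i else d (i - m)"
  have "?w 0 = x" "?w (m + n) = z"
    using c d by auto
  moreover have "R (?w i) (?w (Suc i))" if i: "i < m + n" for i
  proof (cases "Suc i < m")
    case False
    then consider "Suc i = m" | "m \<le> i"
      by linarith
    then show ?thesis
    proof cases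
      case 1
      then show ?thesis
        using c(2) c(3)[of i] d(1) by auto
    next
      case 2
      then show ?thesis
        using d(3)[of "i - m"] i by (simp add: Suc_diff_le)
    qed
  qed (use c in auto)
  moreover have "c ` {..<m} \<union> d ` {..<n} \<subseteq> ?w ` {..<m + n}"
  proof -
    have "c i \<in> ?w ` {..<m + n}" if "i < m" for i
      using that by (intro image_eqI[of _ _ i]) auto
    moreover have "d i \<in> ?w ` {..<m + n}" if "i < n" for i
      using that by (intro image_eqI[of _ _ "m + i"]) auto
    ultimately show ?thesis
      by blast
  qed
  ultimately show thesis
    by (rule that)
qed

text \<open>
  A loop at \<open>x\<close> is enlarged by a detour to the new point and back.
\<close>

lemma closed_chain_through_finite_set:
  assumes R: "\<And>x y. R\<^sup>+\<^sup>+ x y" and S: "finite S"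
  shows "\<exists>L\<ge>1. \<exists>w :: nat \<Rightarrow> 'a. w 0 = x \<and> w L = x \<and> (\<forall>i<L. R (w i) (w (Suc i))) \<and> S \<subseteq> w ` {..<L}"
proof -
  have chain: "\<exists>n\<ge>1. \<exists>c. c 0 = x \<and> c n = y \<and> (\<forall>i<n. R (c i) (c (Suc i)))" for x y
    using R[of x y] unfolding tranclp_power relpowp_fun_conv by (simp add: Suc_le_eq)
  from S show ?thesis
  proof (induction S)
    case empty
    then show ?case
      using chain[of x x] by auto
  next
    case (insert s S)
    obtain L w where w: "L \<ge> 1" "w 0 = x" "w L = x" "\<And>i. i < L \<Longrightarrow> R (w i) (w (Suc i))" "S \<subseteq> w ` {..<L}"
      using insert.IH by blast
    obtain m c where c: "m \<ge> 1" "c 0 = x" "c m = s" "\<And>i. i < m \<Longrightarrow> R (c i) (c (Suc i))"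
      using chain[of x s] by blast
    obtain n d where d: "n \<ge> 1" "d 0 = s" "d n = x" "\<And>i. i < n \<Longrightarrow> R (d i) (d (Suc i))"
      using chain[of s x] by blast
    obtain v where v: "v 0 = x" "v (m + n) = x" "\<And>i. i < m + n \<Longrightarrow> R (v i) (v (Suc i))"
      "c ` {..<m} \<union> d ` {..<n} \<subseteq> v ` {..<m + n}"
      using chain_concat[of c x m s R d n x] c d by metis
    obtain u where u: "u 0 = x" "u (L + (m + n)) = x" "\<And>i. i < L + (m + n) \<Longrightarrow> R (u i) (u (Suc i))"
      "w ` {..<L} \<union> v ` {..<m + n} \<subseteq> u ` {..<L + (m + n)}"
      using chain_concat[of w x L x R v "m + n" x] w v by metis
    have "s \<in> d ` {..<n}"
      using d(1,2) by (intro image_eqI[of _ _ 0]) auto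
    then have "insert s S \<subseteq> u ` {..<L + (m + n)}"
      using w(5) v(4) u(4) by blast
    then show ?case
      using u(1-3) w(1) by (intro exI[of _ "L + (m + n)"] conjI exI[of _ u]) auto
  qed
qed

section \<open>Density of conjugacy classes with many cyclic factors\<close>

text \<open>
  Any two colourings with the same set of colours differ by a homeomorphism of the Cantor space.
\<close>

lemma homeomorphism_matching_colours:
  fixes p q :: "'a::metric_space \<Rightarrow> nat"
  assumes X: "cantor_space (UNIV :: 'a set)"
    and p: "continuous_on UNIV p" and q: "continuous_on UNIV q" and pq: "range p = range q"
  obtains h h' where "homeomorphism UNIV UNIV h h'" "\<And>x. q (h x) = p x"
proof -
  have "top_of_set {x. p x = i} homeomorphic_space top_of_set {x. q x = i}" for i
  proof (cases "i \<in> range p")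
    case True
    then have "i \<in> range q"
      using pq by simp
    then have "{x. p x = i} \<noteq> {}" "{x. q x = i} \<noteq> {}"
      using True by auto
    then show ?thesis
      by (intro clopen_homeomorphic_clopen[OF X] clopen_colour[OF p] clopen_colour[OF q])
  next
    case False
    then have "i \<notin> range q"
      using pq by simp
    then have "{x. p x = i} = {}" "{x. q x = i} = {}"
      using False by auto
    then show ?thesis
      by (metis homeomorphic_space_refl)
  qed
  then obtain h where "homeomorphic_map euclidean euclidean h" "\<And>x. q (h x) = p x"
    using homeomorphic_map_by_colour[OF continuous_map_colour[OF p] continuous_map_colour[OF q]] by auto
  then show thesis
    using that by (auto simp: homeomorphic_map_maps homeomorphic_maps_euclidean_iff)
qed

text \<open>
  The heart of the density statements. A chain transitive \<open>f\<close> has a closed pseudo-orbit \<open>w\<close>, of some length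
  \<open>L\<close>, through all pieces of a fine partition. If \<open>F\<close> permutes \<open>L\<close> clopen sets cyclically, send the
  \<open>i\<close>-th of them to the piece containing \<open>w i\<close>. Several of these sets may be sent to the same piece; their
  union and the piece are nonempty clopen sets, hence homeomorphic, and a homeomorphism realising all these
  identifications conjugates \<open>F\<close> to a map that moves the pieces as \<open>f\<close> moves the points \<open>w i\<close>. As the
  pieces are small this map is close to \<open>f\<close>.
\<close>

lemma conjugate_approximates_chain_transitive:
  fixes f :: "'a::metric_space \<Rightarrow>\<^sub>C 'a"
  assumes X: "cantor_space (UNIV :: 'a set)" and f: "f \<in> CT" and e: "e > 0"
  shows "\<exists>L\<ge>1. \<forall>F\<in>Cs. \<forall>c. cyclic_factor (apply_bcontfun F) L c \<longrightarrow> (\<exists>G\<in>conj_class F. dist G f < e)"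
proof -
  note cX = cantor_spaceD(1)[OF X]
  have "uniformly_continuous_on UNIV (apply_bcontfun f)"
    using cX by (intro compact_uniformly_continuous) (auto intro: continuous_intros)
  then obtain \<delta> where \<delta>: "\<delta> > 0" "\<And>x y. dist x y < \<delta> \<Longrightarrow> dist (f x) (f y) < e / 4"
    using e unfolding uniformly_continuous_on_def by (metis UNIV_I zero_less_divide_iff zero_less_numeral)
  \<comment> \<open>Pieces below \<open>\<delta>\<close> make \<open>f\<close> nearly constant on a piece, pieces below \<open>e / 4\<close> make their points interchangeable.\<close>
  have "min \<delta> (e / 4) > 0"
    using \<delta>(1) e by simp
  then obtain q :: "'a \<Rightarrow> nat" where q: "continuous_on UNIV q" "\<And>x y. q x = q y \<Longrightarrow> dist x y < min \<delta> (e / 4)"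
    using fine_colouring[OF X] by metis
  obtain \<eta> where \<eta>: "\<eta> > 0" "\<And>x y. dist x y < \<eta> \<Longrightarrow> q x = q y"
    using uniform_colour[OF cX q(1)] by metis
  have "finite (range q)"
    using image_compactin[OF _ continuous_map_colour[OF q(1)], of UNIV] cX
    by (simp add: compactin_discrete_topology)
  then obtain S where S: "finite S" "q ` S = range q"
    by (metis finite_subset_image subset_refl)
  obtain L w where L: "L \<ge> 1" and w: "w L = w 0" "\<And>i. i < L \<Longrightarrow> dist (f (w i)) (w (Suc i)) < \<eta>"
    "S \<subseteq> w ` {..<L}"
  proof -
    have "(\<lambda>a b. dist (f a) b < \<eta>)\<^sup>+\<^sup>+ x y" for x y
      using f \<eta>(1) by (simp add: CT_def chain_transitive_iff_tranclp)
    from closed_chain_through_finite_set[of "\<lambda>a b. dist (f a) b < \<eta>", OF this S(1), of undefined]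
    obtain L w where "L \<ge> 1" "w 0 = undefined" "w L = undefined"
      "\<forall>i<L. dist (f (w i)) (w (Suc i)) < \<eta>" "S \<subseteq> w ` {..<L}"
      by blast
    then show thesis
      using that[of L w] by simp
  qed
  have "\<exists>G\<in>conj_class F. dist G f < e" if F: "F \<in> Cs" and c: "cyclic_factor (apply_bcontfun F) L c" for F c
  proof -
    \<comment> \<open>\<open>p\<close> names the piece in which the conjugating homeomorphism has to put \<open>x\<close>.\<close>
    define p where "p x = q (w (c x))" for x
    have p: "continuous_on UNIV p"
      using c continuous_on_nat_comp[of c "\<lambda>i. q (w i)"] by (simp add: p_def cyclic_factor_def)
    have "i \<in> range p" if i: "i \<in> range q" for i
    proof -
      obtain j where j: "j < L" "q (w j) = i"
      proof -
        have "i \<in> q ` S"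
          using i S(2) by simp
        then show thesis
          using w(3) that by blast
      qed
      then obtain n where "c ((apply_bcontfun F ^^ n) undefined) = j"
        using cyclic_factor_hits[OF c] by metis
      then show ?thesis
        using j(2) unfolding p_def by (metis rangeI)
    qed
    then have "range p = range q"
      by (auto simp: p_def)
    then obtain h h' where h: "homeomorphism UNIV UNIV h h'" and qh: "\<And>x. q (h x) = p x"
      using homeomorphism_matching_colours[OF X p q(1)] by metis
    have hh: "h (h' x) = x" "h' (h x) = x" for x
      using h by (auto simp: homeomorphism_def)
    have "continuous_on UNIV (h \<circ> apply_bcontfun F \<circ> h')"
      using h unfolding homeomorphism_def
      by (intro continuous_on_compose) (auto intro: continuous_intros elim: continuous_on_subset)
    then obtain G :: "'a \<Rightarrow>\<^sub>C 'a" where G: "apply_bcontfun G = h \<circ> apply_bcontfun F \<circ> h'"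
      using continuous_on_imp_bcontfun[OF cX, of "h \<circ> apply_bcontfun F \<circ> h'"] by auto
    have "surj (h \<circ> apply_bcontfun F \<circ> h')"
      using F h by (intro comp_surj) (auto simp: Cs_def homeomorphism_def)
    then have "G \<in> conj_class F"
      using h G by (auto simp: conj_class_def Cs_def)
    moreover have "dist (G x) (f x) \<le> e / 2" for x
    proof -
      define z where "z = h' x"
      define u where "u = w (c z)"
      have cz: "c z < L" "c (F z) = (c z + 1) mod L"
        using c by (auto simp: cyclic_factor_def)
      have "q x = q u"
        using qh[of z] by (simp add: z_def u_def p_def hh)
      then have 1: "dist (f x) (f u) < e / 4"
        using q(2)[of x u] \<delta>(2)[of x u] by simp
      have "w (c (F z)) = w (Suc (c z))"
        using cz w(1) by (cases "Suc (c z) = L") auto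
      then have "q (G x) = q (w (Suc (c z)))"
        using qh[of "F z"] by (simp add: G z_def p_def)
      also have "\<dots> = q (f u)"
        using \<eta>(2)[OF w(2)[OF cz(1)]] by (simp add: u_def)
      finally have "dist (G x) (f u) < e / 4"
        using q(2)[of "G x" "f u"] by simp
      then show ?thesis
        using 1 dist_triangle2[of "G x" "f x" "f u"] by linarith
    qed
    then have "dist G f \<le> e / 2"
      by (rule dist_bound)
    then have "dist G f < e"
      using e by simp
    ultimately show ?thesis
      by blast
  qed
  then show ?thesis
    using L by blast
qed

lemma CT_subset_closure:
  fixes \<F> :: "('a::metric_space \<Rightarrow>\<^sub>C 'a) set"
  assumes X: "cantor_space (UNIV :: 'a set)" and F: "\<F> \<subseteq> Cs"
    and cyc: "\<And>L. L \<ge> 1 \<Longrightarrow> \<exists>F\<in>\<F>. \<exists>c. cyclic_factor (apply_bcontfun F) L c"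
  shows "CT \<subseteq> (top_of_set Cs) closure_of (\<Union>F\<in>\<F>. conj_class F)"
proof
  fix f :: "'a \<Rightarrow>\<^sub>C 'a" assume f: "f \<in> CT"
  have "\<exists>g\<in>\<Union>F\<in>\<F>. conj_class F. dist g f < e" if e: "e > 0" for e
  proof -
    obtain L where L: "L \<ge> 1" "\<And>F c. F \<in> Cs \<Longrightarrow> cyclic_factor (apply_bcontfun F) L c \<Longrightarrow>
        \<exists>G\<in>conj_class F. dist G f < e"
      using conjugate_approximates_chain_transitive[OF X f e] by blast
    then obtain F c where "F \<in> \<F>" "cyclic_factor (apply_bcontfun F) L c"
      using cyc by blast
    then show ?thesis
      using L(2) F by blast
  qed
  moreover have "(\<Union>F\<in>\<F>. conj_class F) \<subseteq> Cs"
    by (auto simp: conj_class_def)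
  ultimately show "f \<in> (top_of_set Cs) closure_of (\<Union>F\<in>\<F>. conj_class F)"
    using f by (simp add: closure_of_Cs_iff CT_def)
qed

lemma universal_adding_machine_transitive:
  fixes F :: "'a::metric_space \<Rightarrow>\<^sub>C 'a"
  assumes X: "cantor_space (UNIV :: 'a set)" and k: "universal_sequence k"
    and F: "F \<in> Cs" "isomorphic_to F (adding_machine_space k) (adding_machine k)"
  shows "transitive_element CT F"
proof -
  note cX = cantor_spaceD(1)[OF X]
  have div: "divisibility_sequence k"
    using k by (simp add: universal_sequence_def)
  obtain c where c: "residue_tower k UNIV c" "\<And>n. n \<ge> 1 \<Longrightarrow> cyclic_factor (apply_bcontfun F) (k n) (c n)"
    using F(2) isomorphic_to_adding_machine_iff[OF cX div] by blast
  have "chain_transitive (apply_bcontfun F)"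
  proof (rule chain_transitive_fine_cyclic_factors)
    fix e :: real assume "e > 0"
    then show "\<exists>L c. cyclic_factor (apply_bcontfun F) L c \<and> (\<forall>x y. c x = c y \<longrightarrow> dist x y < e)"
      using residue_tower_mesh[OF cX c(1)] c(2) by (meson UNIV_I order_refl)
  qed
  then have FCT: "F \<in> CT"
    using F(1) by (simp add: CT_def)
  have "\<exists>c. cyclic_factor (apply_bcontfun F) L c" if L: "L \<ge> 1" for L
  proof -
    obtain N where "\<And>n. n \<ge> N \<Longrightarrow> L dvd k n"
      using k L unfolding universal_sequence_def eventually_sequentially by blast
    then have "L dvd k (max N 1)"
      by simp
    then show ?thesis
      using cyclic_factor_dvd[OF c(2)[of "max N 1"]] by auto
  qed
  then have "CT \<subseteq> (top_of_set Cs) closure_of (\<Union>F\<in>{F}. conj_class F)"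
    using F(1) by (intro CT_subset_closure[OF X]) auto
  moreover have "(top_of_set Cs) closure_of conj_class F \<subseteq> CT"
    using conj_class_subset_CT[OF cX FCT] closedin_CT by (rule closure_of_minimal)
  ultimately show ?thesis
    using FCT by (auto simp: transitive_element_def)
qed

section \<open>Suspensions\<close>

lemma topspace_suspension_space: "topspace (suspension_space N) = UNIV \<times> {1..N}"
  by (simp add: suspension_space_def)

lemma continuous_map_suspension_level:
  "continuous_map (suspension_space N) (discrete_topology UNIV) snd"
proof -
  have "continuous_map (suspension_space N) (discrete_topology {1..N}) snd"
    by (simp add: suspension_space_def continuous_map_snd)
  moreover have "discrete_topology {1..N} = subtopology (discrete_topology UNIV) {1..N}"
    by simp
  ultimately show ?thesis
    by (metis continuous_map_into_fulltopology)
qed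

text \<open>
  Each level of the suspension is a copy of the base space.
\<close>

lemma suspension_level_homeomorphic:
  assumes "i \<in> {1..N}"
  shows "subtopology (suspension_space N :: ('a \<times> nat) topology) {z \<in> topspace (suspension_space N). snd z = i}
           homeomorphic_space (euclidean :: 'a::metric_space topology)"
proof -
  let ?S = "{z \<in> topspace (suspension_space N :: ('a \<times> nat) topology). snd z = i}"
  have "continuous_map (suspension_space N) euclidean (fst :: 'a \<times> nat \<Rightarrow> 'a)"
    by (simp add: suspension_space_def continuous_map_fst)
  then have "continuous_map (subtopology (suspension_space N) ?S) euclidean fst"
    by (rule continuous_map_from_subtopology)
  moreover have "continuous_map euclidean (suspension_space N) (\<lambda>x :: 'a. (x, i))"
    using assms unfolding suspension_space_def by (intro continuous_map_pairedI) auto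
  then have "continuous_map euclidean (subtopology (suspension_space N) ?S) (\<lambda>x :: 'a. (x, i))"
    using assms by (auto simp: continuous_map_in_subtopology topspace_suspension_space)
  ultimately have "homeomorphic_maps (subtopology (suspension_space N) ?S) euclidean fst (\<lambda>x. (x, i))"
    by (auto simp: homeomorphic_maps_def)
  then show ?thesis
    unfolding homeomorphic_space_def by blast
qed

text \<open>
  The Cantor space splits into \<open>N\<close> nonempty clopen sets, each of them homeomorphic to the whole space and
  thus to a level of the suspension.
\<close>

lemma suspension_space_homeomorphic:
  assumes X: "cantor_space (UNIV :: 'a::metric_space set)" and N: "N \<ge> 1"
  shows "\<exists>h :: 'a \<times> nat \<Rightarrow> 'a. homeomorphic_map (suspension_space N) euclidean h"
proof -
  obtain d :: "'a \<Rightarrow> nat" where d: "continuous_on UNIV d" "range d = {0..<N}"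
    using split_clopen[OF X N, of UNIV] by auto
  define q where "q x = Suc (d x)" for x
  have q: "continuous_on UNIV q"
    unfolding q_def using d(1) by (rule continuous_on_nat_comp)
  have rq: "range q = {1..N}"
  proof -
    have "range q = Suc ` range d"
      by (auto simp: q_def)
    then show ?thesis
      by (auto simp: d(2) image_Suc_atLeastLessThan)
  qed
  have "subtopology (suspension_space N :: ('a \<times> nat) topology)
        {z \<in> topspace (suspension_space N). snd z = i} homeomorphic_space
      subtopology (euclidean :: 'a topology) {x \<in> topspace euclidean. q x = i}" for i
  proof (cases "i \<in> {1..N}")
    case True
    then have "i \<in> range q"
      using rq by simp
    then have "{x. q x = i} \<noteq> {}"
      by auto
    then have eq: "top_of_set (UNIV :: 'a set) homeomorphic_space top_of_set {x. q x = i}"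
      by (intro clopen_homeomorphic_clopen[OF X open_UNIV closed_UNIV UNIV_not_empty] clopen_colour[OF q])
    then show ?thesis
      using homeomorphic_space_trans[OF suspension_level_homeomorphic[OF True, where 'a = 'a]] by simp
  next
    case False
    have "i \<notin> range q"
      using False rq by simp
    then have "{x. q x = i} = {}"
      by auto
    moreover have "{z \<in> topspace (suspension_space N :: ('a \<times> nat) topology). snd z = i} = {}"
      using False by (auto simp: topspace_suspension_space)
    ultimately show ?thesis
      by (simp only: topspace_euclidean UNIV_I simp_thms subtopology_empty_iff_trivial)
        (simp add: homeomorphic_empty_space_eq)
  qed
  then show ?thesis
    using homeomorphic_map_by_colour[OF continuous_map_suspension_level continuous_map_colour[OF q]] by blast
qed

lemma continuous_map_suspension:
  assumes N: "N \<ge> 1" and g: "continuous_on UNIV (g :: 'a::metric_space \<Rightarrow> 'a)"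
  shows "continuous_map (suspension_space N) (suspension_space N) (suspension N g)"
proof (rule pasting_lemma)
  let ?T = "\<lambda>i. {z \<in> topspace (suspension_space N :: ('a \<times> nat) topology). snd z = i}"
  let ?f = "\<lambda>i z. if i < N then (fst z, i + 1) else (g (fst z), 1)"
  show "openin (suspension_space N) (?T i)" if "i \<in> {1..N}" for i
    using openin_continuous_map_preimage[OF continuous_map_suspension_level, of "{i}"] by auto
  show "continuous_map (subtopology (suspension_space N) (?T i)) (suspension_space N) (?f i)"
    if "i \<in> {1..N}" for i
  proof (rule continuous_map_from_subtopology)
    have "continuous_map (suspension_space N) euclidean (fst :: 'a \<times> nat \<Rightarrow> 'a)"
      by (simp add: suspension_space_def continuous_map_fst)
    moreover from this have "continuous_map (suspension_space N) euclidean (\<lambda>z :: 'a \<times> nat. g (fst z))"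
      using continuous_map_compose[of _ euclidean fst euclidean g] g by (simp add: o_def)
    ultimately show "continuous_map (suspension_space N) (suspension_space N) (?f i)"
      using N that unfolding suspension_space_def
      by (cases "i < N") (auto intro!: continuous_map_pairedI)
  qed
  show "?f i x = ?f j x" if "i \<in> {1..N}" "j \<in> {1..N}" "x \<in> topspace (suspension_space N) \<inter> ?T i \<inter> ?T j" for i j x
    using that by simp
  show "\<exists>j. j \<in> {1..N} \<and> x \<in> ?T j \<and> suspension N g x = ?f j x" if "x \<in> topspace (suspension_space N)" for x
    using that by (auto simp: topspace_suspension_space suspension_def split: prod.splits)
qed

lemma suspension_surj:
  assumes N: "N \<ge> 1" and g: "surj (g :: 'a::metric_space \<Rightarrow> 'a)"
  shows "suspension N g ` topspace (suspension_space N) = topspace (suspension_space N)"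
proof (intro equalityI subsetI)
  fix z assume z: "z \<in> topspace (suspension_space N :: ('a \<times> nat) topology)"
  show "z \<in> suspension N g ` topspace (suspension_space N)"
  proof (cases "snd z = 1")
    case True
    obtain x where "fst z = g x"
      using g by (metis surjD)
    then have "z = suspension N g (x, N)"
      using True by (auto simp: suspension_def prod_eq_iff)
    then show ?thesis
      using N by (auto simp: topspace_suspension_space)
  next
    case False
    then have "z = suspension N g (fst z, snd z - 1)" "(fst z, snd z - 1) \<in> topspace (suspension_space N)"
      using z by (auto simp: suspension_def topspace_suspension_space prod_eq_iff)
    then show ?thesis
      by (rule image_eqI)
  qed
qed (use N in \<open>auto simp: topspace_suspension_space suspension_def split: if_splits\<close>)

text \<open>
  The level, read modulo a divisor of \<open>N\<close>, advances by one under the suspension: from the top level \<open>N\<close>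
  the map returns to level \<open>1\<close>, and \<open>L\<close> divides \<open>N\<close>.
\<close>

lemma suspension_cyclic_factor:
  assumes G: "isomorphic_to G (suspension_space N) (suspension N g)" and L: "L dvd N" "N \<ge> 1"
  shows "\<exists>c. cyclic_factor (apply_bcontfun (G :: 'a::metric_space \<Rightarrow>\<^sub>C 'a)) L c"
proof -
  obtain h where h: "homeomorphic_map (suspension_space N) euclidean h"
    "\<And>z. z \<in> topspace (suspension_space N) \<Longrightarrow> h (suspension N g z) = G (h z)"
    using G by (auto simp: isomorphic_to_def)
  then obtain b where b: "homeomorphic_maps (suspension_space N) euclidean h b"
    by (auto simp: homeomorphic_map_maps)
  have bT: "b x \<in> topspace (suspension_space N)" "h (b x) = x" for x
    using b by (auto simp: homeomorphic_maps_def continuous_map_def Pi_iff)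
  have "0 < L"
    using L by (auto intro: gr0I)
  have "continuous_on UNIV (\<lambda>x. snd (b x))"
    using b continuous_map_compose[of euclidean "suspension_space N" b, OF _ continuous_map_suspension_level]
    by (simp add: homeomorphic_maps_def o_def continuous_map_nat_iff)
  then have "continuous_on UNIV (\<lambda>x. snd (b x) mod L)"
    by (rule continuous_on_nat_comp)
  moreover have "snd (b (G x)) mod L = (snd (b x) mod L + 1) mod L" for x
  proof -
    have sT: "suspension N g (b x) \<in> topspace (suspension_space N)"
      using bT(1)[of x] L(2) by (auto simp: topspace_suspension_space suspension_def)
    have "b (G x) = b (h (suspension N g (b x)))"
      using h(2)[OF bT(1)] bT(2) by simp
    also have "\<dots> = suspension N g (b x)"
      using b sT by (auto simp: homeomorphic_maps_def)
    finally have eq: "b (G x) = suspension N g (b x)" .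
    show ?thesis
    proof (cases "snd (b x) < N")
      case True
      then show ?thesis
        by (simp add: eq suspension_def split_beta mod_Suc_eq)
    next
      case False
      then have "snd (b x) = N"
        using bT(1)[of x] by (auto simp: topspace_suspension_space)
      then show ?thesis
        using L(1) by (simp add: eq suspension_def split_beta)
    qed
  qed
  ultimately show ?thesis
    using \<open>0 < L\<close> by (intro exI[of _ "\<lambda>x. snd (b x) mod L"]) (simp add: cyclic_factor_def)
qed

text \<open>
  The suspension climbs the levels without error, so jumps are only needed on the way from the top level
  to the bottom one, where they are those of a chain of \<open>g\<close>.
\<close>

lemma suspension_CT:
  fixes g G :: "'a::metric_space \<Rightarrow>\<^sub>C 'a"
  assumes X: "compact (UNIV :: 'a set)" and g: "g \<in> CT" and N: "N \<ge> 1"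
    and G: "G \<in> Cs" "isomorphic_to G (suspension_space N) (suspension N (apply_bcontfun g))"
  shows "G \<in> CT"
proof -
  obtain h where h: "homeomorphic_map (suspension_space N) euclidean h"
    "\<And>z. z \<in> topspace (suspension_space N) \<Longrightarrow> h (suspension N (apply_bcontfun g) z) = G (h z)"
    using G(2) by (auto simp: isomorphic_to_def)
  have surjh: "\<exists>x i. i \<in> {1..N} \<and> h (x, i) = y" for y
  proof -
    have "y \<in> h ` (UNIV \<times> {1..N})"
      using homeomorphic_imp_surjective_map[OF h(1)] by (simp add: topspace_suspension_space)
    then show ?thesis
      by blast
  qed
  have up: "G (h (x, i)) = h (x, Suc i)" if "i \<in> {1..<N}" for x i
    using h(2)[of "(x, i)"] that by (simp add: topspace_suspension_space suspension_def)
  have top: "G (h (x, N)) = h (g x, 1)" for x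
    using h(2)[of "(x, N)"] N by (simp add: topspace_suspension_space suspension_def)
  have "continuous_on UNIV (\<lambda>x. h (x, 1))"
  proof -
    have "continuous_map euclidean (suspension_space N) (\<lambda>x. (x, 1))"
      using N unfolding suspension_space_def by (intro continuous_map_pairedI) auto
    then show ?thesis
      using continuous_map_compose[OF _ homeomorphic_imp_continuous_map[OF h(1)]] by (fastforce simp: o_def)
  qed
  then have uni: "uniformly_continuous_on UNIV (\<lambda>x. h (x, 1))"
    using X by (rule compact_uniformly_continuous)
  have "(\<lambda>a b. dist (G a) b < e)\<^sup>+\<^sup>+ y y'" if e: "e > 0" for e y y'
  proof -
    let ?R = "\<lambda>a b. dist (G a) b < e"
    obtain \<delta> where \<delta>: "\<delta> > 0" "\<And>x x'. dist x x' < \<delta> \<Longrightarrow> dist (h (x, 1)) (h (x', 1)) < e"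
      using uni e unfolding uniformly_continuous_on_def by (metis UNIV_I)
    have climb: "?R\<^sup>*\<^sup>* (h (x, i)) (h (x, j))" if "i \<ge> 1" "i \<le> j" "j \<le> N" for x i j
      using that(2,3)
    proof (induction j rule: dec_induct)
      case (step j)
      then have "?R (h (x, j)) (h (x, Suc j))"
        using up[of j x] e that(1) by simp
      then show ?case
        using step by (meson Suc_leD rtranclp.rtrancl_into_rtrancl)
    qed simp
    have jump: "?R (h (x, N)) (h (x', 1))" if "dist (g x) x' < \<delta>" for x x'
      using \<delta>(2)[OF that] by (simp add: top)
    obtain x i x' j where xy: "i \<in> {1..N}" "h (x, i) = y" "j \<in> {1..N}" "h (x', j) = y'"
      using surjh[of y] surjh[of y'] by blast
    \<comment> \<open>The chain of \<open>g\<close> ends one step before \<open>x'\<close>, so that the last passage from the top leads to \<open>(x', 1)\<close>.\<close>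
    obtain z where z: "g z = x'"
      using g by (auto simp: CT_def Cs_def) (metis surjD)
    have "(\<lambda>a b. dist (g a) b < \<delta>)\<^sup>+\<^sup>+ x z"
      using g \<delta>(1) by (simp add: CT_def chain_transitive_iff_tranclp)
    then have "?R\<^sup>+\<^sup>+ (h (x, N)) (h (z, N))"
    proof (rule tranclp_image[where h = "\<lambda>x. h (x, N)"])
      fix a b assume "dist (g a) b < \<delta>"
      then show "?R\<^sup>+\<^sup>+ (h (a, N)) (h (b, N))"
        using jump climb[of 1 N b] N by (meson order_refl rtranclp_into_tranclp2)
    qed
    moreover have "?R\<^sup>*\<^sup>* y (h (x, N))"
      using climb[of i N x] xy by auto
    moreover have "?R\<^sup>*\<^sup>* (h (z, N)) y'"
    proof -
      have "?R (h (z, N)) (h (x', 1))"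
        using jump[of z x'] z \<delta>(1) by simp
      moreover have "?R\<^sup>*\<^sup>* (h (x', 1)) y'"
        using climb[of 1 j x'] xy by auto
      ultimately show ?thesis
        by (rule converse_rtranclp_into_rtranclp)
    qed
    ultimately show ?thesis
      by (meson rtranclp_tranclp_tranclp tranclp_rtranclp_tranclp)
  qed
  then show ?thesis
    using G(1) unfolding CT_def chain_transitive_iff_tranclp by blast
qed

section \<open>The tower of finite cyclic groups\<close>

lemma system_surjection_graph_on_iff:
  "f ` I \<subseteq> I \<Longrightarrow> system_surjection q I (graph_on I f) J (graph_on J g) \<longleftrightarrow>
     q ` I = J \<and> (\<forall>x\<in>I. q (f x) = g (q x))"
  unfolding system_surjection_def graph_on_def by (auto 0 4 simp: image_iff set_eq_iff)

lemma cyc_shift_bij: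
  assumes "0 < k n"
  shows "cyc_shift k n ` cyc k n = cyc k n" "inj_on (cyc_shift k n) (cyc k n)"
proof -
  show surj: "cyc_shift k n ` cyc k n = cyc k n"
  proof (intro equalityI subsetI)
    fix i assume "i \<in> cyc k n"
    then have "cyc_shift k n ((i + (k n - 1)) mod k n) = i"
      using assms by (simp add: cyc_def cyc_shift_def mod_Suc_eq)
    then show "i \<in> cyc_shift k n ` cyc k n"
      using assms by (intro image_eqI[of _ _ "(i + (k n - 1)) mod k n"]) (auto simp: cyc_def)
  qed (use assms in \<open>auto simp: cyc_def cyc_shift_def\<close>)
  show "inj_on (cyc_shift k n) (cyc k n)"
    by (rule eq_card_imp_inj_on) (simp_all add: surj, simp add: cyc_def)
qed

lemma bond_cyc_proj:
  assumes k: "divisibility_sequence k" and n: "1 \<le> n" "n < m"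
  shows "bond (cyc_proj k) m n x = x mod k n"
  using n(2)
proof (induction m arbitrary: x)
  case (Suc m)
  show ?case
  proof (cases "n = m")
    case True
    then show ?thesis
      using n(1) by (cases m) (auto simp: cyc_proj_def)
  next
    case False
    then show ?thesis
      using Suc divisibility_sequence_dvd[OF k n(1), of m] by (simp add: cyc_proj_def mod_mod_cancel)
  qed
qed simp

text \<open>
  Reduction followed by a translation is equivariant for translation by one. Up to the choice of \<open>b\<close> these
  are the only system surjections between cyclic groups, which is the reason for the factoring property.
\<close>

lemma cyc_system_surjection:
  assumes k: "divisibility_sequence k" and mn: "1 \<le> n" "n \<le> m" "1 \<le> m"
  shows "system_surjection (\<lambda>x. (x + b) mod k n) (cyc k m) (cyc_rel k m) (cyc k n) (cyc_rel k n)"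
proof -
  note pos = divisibility_sequence_pos[OF k mn(1)] divisibility_sequence_pos[OF k mn(3)]
  have dvd: "k n dvd k m"
    using divisibility_sequence_dvd[OF k mn(1,2)] .
  have "(\<lambda>x. (x + b) mod k n) ` cyc k m = cyc k n"
  proof (intro equalityI subsetI)
    fix i assume i: "i \<in> cyc k n"
    let ?x = "(i + (k n - b mod k n)) mod k n"
    have "(?x + b) mod k n = (i + (k n - b mod k n) + b mod k n) mod k n"
      by (simp add: mod_simps)
    also have "i + (k n - b mod k n) + b mod k n = i + k n"
      using mod_less_divisor[OF pos(1), of b] by linarith
    finally have "(?x + b) mod k n = i"
      using i by (simp add: cyc_def)
    moreover have "?x < k m"
      using pos dvd_imp_le[OF dvd pos(2)] by (meson less_le_trans mod_less_divisor)
    ultimately show "i \<in> (\<lambda>x. (x + b) mod k n) ` cyc k m"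
      by (intro image_eqI[of _ _ ?x]) (auto simp: cyc_def)
  qed (use pos in \<open>auto simp: cyc_def\<close>)
  moreover have "(cyc_shift k m x + b) mod k n = cyc_shift k n ((x + b) mod k n)" for x
  proof -
    have "(cyc_shift k m x + b) mod k n = (cyc_shift k m x mod k n + b) mod k n"
      by (simp add: mod_simps)
    also have "cyc_shift k m x mod k n = (x + 1) mod k n"
      using dvd by (simp add: cyc_shift_def mod_mod_cancel)
    finally show ?thesis
      by (simp add: cyc_shift_def mod_simps)
  qed
  ultimately show ?thesis
    unfolding cyc_rel_def using cyc_shift_bij(1)[of k m, OF pos(2)]
    by (subst system_surjection_graph_on_iff) auto
qed

text \<open>
  The relations are graphs of bijections, hence maps in both time directions, and every fibre of the
  bonding map has at least two points since \<open>k n\<close> at least doubles.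
\<close>

lemma cyc_invertible_shimomura_sequence:
  assumes k: "divisibility_sequence k"
  shows "invertible_shimomura_sequence (cyc k) (cyc_rel k) (cyc_proj k)"
proof -
  note pos = divisibility_sequence_pos[OF k]
  have "surjective_relation (cyc k n) (cyc_rel k n)" if n: "n \<ge> 1" for n
  proof -
    have eq: "cyc_rel k n = (\<lambda>x. (x, cyc_shift k n x)) ` cyc k n"
      by (auto simp: cyc_rel_def graph_on_def)
    show ?thesis
      using cyc_shift_bij(1)[of k n, OF pos[OF n]] unfolding surjective_relation_def eq image_image
      by auto
  qed
  moreover have "system_surjection (cyc_proj k n) (cyc k (Suc n)) (cyc_rel k (Suc n)) (cyc k n) (cyc_rel k n)"
    if "n \<ge> 1" for n
    using cyc_system_surjection[OF k that, of "Suc n" 0] by (simp add: cyc_proj_def[abs_def])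
  ultimately have sys: "system_sequence (cyc k) (cyc_rel k) (cyc_proj k)"
    by (simp add: system_sequence_def cyc_def)
  have split: "\<exists>m>n. \<exists>y1\<in>cyc k m. \<exists>y2\<in>cyc k m. y1 \<noteq> y2 \<and> bond (cyc_proj k) m n y1 = x \<and> bond (cyc_proj k) m n y2 = x"
    if n: "n \<ge> 1" and x: "x \<in> cyc k n" for n x
  proof -
    obtain r where r: "r \<ge> 2" "k (Suc n) = k n * r"
      using divisibility_sequence_mult[OF k n] .
    have "k n * 2 \<le> k n * r"
      using r(1) by (rule mult_le_mono2)
    then have "k n * 2 \<le> k (Suc n)"
      using r(2) by simp
    then have "x \<in> cyc k (Suc n)" "x + k n \<in> cyc k (Suc n)"
      using x by (auto simp: cyc_def)
    moreover have "x \<noteq> x + k n"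
      using pos[OF n] by simp
    ultimately show ?thesis
      using bond_cyc_proj[OF k n, of "Suc n"] x
      by (intro exI[of _ "Suc n"] conjI bexI[of _ x] bexI[of _ "x + k n"]) (auto simp: cyc_def)
  qed
  have fwd: "eventually_map (cyc k) (cyc_rel k) (cyc_proj k)"
    unfolding eventually_map_def
  proof (intro allI impI)
    fix n :: nat assume "n \<ge> 1"
    show "\<exists>m>n. is_map_on (cyc k m) {(a, bond (cyc_proj k) m n b) | a b. (a, b) \<in> cyc_rel k m}"
      by (intro exI[of _ "Suc n"]) (auto simp: is_map_on_def cyc_rel_def graph_on_def)
  qed
  have bwd: "eventually_map (cyc k) (\<lambda>n. (cyc_rel k n)\<inverse>) (cyc_proj k)"
    unfolding eventually_map_def
  proof (intro allI impI)
    fix n :: nat assume n: "n \<ge> 1"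
    have "\<exists>!c. (a, c) \<in> {(a, bond (cyc_proj k) (Suc n) n b) | a b. (a, b) \<in> (cyc_rel k (Suc n))\<inverse>}"
      if a: "a \<in> cyc k (Suc n)" for a
    proof -
      have bij: "cyc_shift k (Suc n) ` cyc k (Suc n) = cyc k (Suc n)" "inj_on (cyc_shift k (Suc n)) (cyc k (Suc n))"
        using cyc_shift_bij[of k "Suc n"] pos[of "Suc n"] by auto
      have "a \<in> cyc_shift k (Suc n) ` cyc k (Suc n)"
        using a by (simp only: bij(1))
      then obtain b where b: "b \<in> cyc k (Suc n)" "cyc_shift k (Suc n) b = a"
        by blast
      have "(b', a) \<in> cyc_rel k (Suc n) \<longleftrightarrow> b' = b" for b'
        using b bij(2) by (auto simp: cyc_rel_def graph_on_def inj_on_def)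
      then have "(a, c) \<in> {(a, bond (cyc_proj k) (Suc n) n b) | a b. (a, b) \<in> (cyc_rel k (Suc n))\<inverse>}
          \<longleftrightarrow> c = bond (cyc_proj k) (Suc n) n b" for c
        by auto
      then show ?thesis
        by simp
    qed
    then show "\<exists>m>n. is_map_on (cyc k m) {(a, bond (cyc_proj k) m n b) | a b. (a, b) \<in> (cyc_rel k m)\<inverse>}"
      unfolding is_map_on_def by (intro exI[of _ "Suc n"] conjI ballI lessI)
  qed
  show ?thesis
    unfolding invertible_shimomura_sequence_def shimomura_sequence_def
    using sys split fwd bwd by blast
qed

text \<open>
  Equivariance forces \<open>q i = q 0 + i\<close> modulo \<open>k n\<close>, so \<open>q\<close> is undone by translating by \<open>k n - q 0\<close>, the
  representative of \<open>- q 0\<close> in the natural numbers.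
\<close>

lemma cyc_factoring_property:
  assumes k: "divisibility_sequence k"
  shows "factoring_property (cyc k) (cyc_rel k) (cyc_proj k)"
  unfolding factoring_property_def
proof (intro allI impI)
  fix n l :: nat and q :: "nat \<Rightarrow> nat"
  assume n: "1 \<le> n" and l: "n < l"
    and q: "system_surjection q (cyc k l) (cyc_rel k l) (cyc k n) (cyc_rel k n)"
  have l1: "1 \<le> l"
    using n l by simp
  note pos = divisibility_sequence_pos[OF k n] divisibility_sequence_pos[OF k l1]
  have qim: "q ` cyc k l = cyc k n" and step: "\<And>x. x \<in> cyc k l \<Longrightarrow> q (cyc_shift k l x) = cyc_shift k n (q x)"
    using q cyc_shift_bij(1)[of k l, OF pos(2)] system_surjection_graph_on_iff[of "cyc_shift k l" "cyc k l" q "cyc k n" "cyc_shift k n"]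
    unfolding cyc_rel_def by auto
  have q0: "q 0 < k n"
    using qim pos(2) by (force simp: cyc_def)
  have q: "q i = (q 0 + i) mod k n" if "i < k l" for i
    using that
  proof (induction i)
    case (Suc i)
    then have "q (Suc i) = q (cyc_shift k l i)"
      by (simp add: cyc_shift_def)
    also have "\<dots> = cyc_shift k n (q i)"
      using Suc.prems by (intro step) (simp add: cyc_def)
    finally show ?case
      using Suc by (simp add: cyc_shift_def mod_Suc_eq)
  qed (use q0 in simp)
  let ?b = "k n - q 0"
  have dvd: "k n dvd k l"
    using divisibility_sequence_dvd[OF k n] l by simp
  have "q ((x + ?b) mod k l) = bond (cyc_proj k) (Suc l) n x" for x
  proof -
    have "q ((x + ?b) mod k l) = (q 0 + (x + ?b) mod k l) mod k n"
      using pos(2) by (intro q) simp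
    also have "\<dots> = (q 0 + (x + ?b) mod k l mod k n) mod k n"
      by (simp add: mod_simps)
    also have "\<dots> = (q 0 + (x + ?b)) mod k n"
      using dvd by (simp add: mod_mod_cancel mod_simps)
    also have "q 0 + (x + ?b) = x + k n"
      using q0 by simp
    finally show ?thesis
      using bond_cyc_proj[OF k n, of "Suc l"] l by simp
  qed
  moreover have "system_surjection (\<lambda>x. (x + ?b) mod k l) (cyc k (Suc l)) (cyc_rel k (Suc l)) (cyc k l) (cyc_rel k l)"
    using cyc_system_surjection[OF k l1, of "Suc l"] by simp
  ultimately show "\<exists>m>l. \<exists>q2. system_surjection q2 (cyc k m) (cyc_rel k m) (cyc k l) (cyc_rel k l) \<and>
      (\<forall>x\<in>cyc k m. q (q2 x) = bond (cyc_proj k) m n x)"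
    by (intro exI[of _ "Suc l"] conjI exI[of _ "\<lambda>x. (x + ?b) mod k l"]) auto
qed

section \<open>Adding machines and the space of chain transitive maps\<close>

theorem theorem4p10:
  assumes X: "cantor_space (UNIV :: 'a::metric_space set)"
  shows
    "(\<forall>k. divisibility_sequence k \<longrightarrow>
        invertible_shimomura_sequence (cyc k) (cyc_rel k) (cyc_proj k) \<and>
        factoring_property (cyc k) (cyc_rel k) (cyc_proj k) \<and>
        (\<exists>F::'a \<Rightarrow>\<^sub>C 'a. F \<in> Cs \<and> isomorphic_to F (adding_machine_space k) (adding_machine k)) \<and>
        (\<forall>F::'a \<Rightarrow>\<^sub>C 'a. F \<in> Cs \<longrightarrow>
           isomorphic_to F (adding_machine_space k) (adding_machine k) \<longrightarrow> residual_type F))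
     \<and>
     (conjugacy_transitive (CT :: ('a \<Rightarrow>\<^sub>C 'a) set) \<and>
      (\<forall>k. universal_sequence k \<longrightarrow>
        (\<forall>F::'a \<Rightarrow>\<^sub>C 'a. F \<in> Cs \<longrightarrow>
           isomorphic_to F (adding_machine_space k) (adding_machine k) \<longrightarrow>
           transitive_element CT F \<and> residual_type F)))
     \<and>
     (\<forall>g \<in> (CT :: ('a \<Rightarrow>\<^sub>C 'a) set).
        (\<forall>n\<ge>1. \<exists>F::'a \<Rightarrow>\<^sub>C 'a. F \<in> Cs \<and>
           isomorphic_to F (suspension_space (fact n)) (suspension (fact n) (apply_bcontfun g))) \<and>
        (\<forall>G :: nat \<Rightarrow> 'a \<Rightarrow>\<^sub>C 'a.
           (\<forall>n\<ge>1. G n \<in> Cs \<and>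
              isomorphic_to (G n) (suspension_space (fact n))
                (suspension (fact n) (apply_bcontfun g))) \<longrightarrow>
           (\<Union>n\<in>{1..}. conj_class (G n)) \<subseteq> CT \<and>
           CT \<subseteq> (top_of_set Cs) closure_of (\<Union>n\<in>{1..}. conj_class (G n))))"
proof -
  note cX = cantor_spaceD(1)[OF X]
  have machine: "\<exists>F::'a \<Rightarrow>\<^sub>C 'a. F \<in> Cs \<and> isomorphic_to F (adding_machine_space k) (adding_machine k)"
    if k: "divisibility_sequence k" for k
  proof -
    have "(euclidean :: 'a topology) homeomorphic_space adding_machine_space k"
      using clopen_homeomorphic_adding_machine_space[OF X k, of UNIV] by simp
    then obtain h :: "(nat \<Rightarrow> nat) \<Rightarrow> 'a" where "homeomorphic_map (adding_machine_space k) euclidean h"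
      using homeomorphic_space_sym homeomorphic_space by metis
    then show ?thesis
      by (intro isomorphic_to_exists[OF cX] continuous_map_adding_machine[OF k] adding_machine_surj[OF k])
  qed
  have residual: "residual_type F"
    if "divisibility_sequence k" "F \<in> Cs" "isomorphic_to F (adding_machine_space k) (adding_machine k)"
    for F :: "'a \<Rightarrow>\<^sub>C 'a" and k
    using adding_machine_residual_type[OF cX that] .
  have transitive: "transitive_element CT F"
    if "universal_sequence k" "F \<in> Cs" "isomorphic_to F (adding_machine_space k) (adding_machine k)"
    for F :: "'a \<Rightarrow>\<^sub>C 'a" and k
    using universal_adding_machine_transitive[OF X that] .
  have div: "divisibility_sequence k" if "universal_sequence k" for k
    using that by (simp add: universal_sequence_def)
  have "\<exists>F :: 'a \<Rightarrow>\<^sub>C 'a. transitive_element CT F"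
    using machine[OF div[OF universal_sequence_fact]] transitive[OF universal_sequence_fact] by blast
  then have CT: "conjugacy_transitive (CT :: ('a \<Rightarrow>\<^sub>C 'a) set)"
    using closedin_CT conj_class_subset_CT[OF cX] by (simp add: conjugacy_transitive_def)
  have suspension: "\<exists>F::'a \<Rightarrow>\<^sub>C 'a. F \<in> Cs \<and> isomorphic_to F (suspension_space N) (suspension N (apply_bcontfun g))"
    if g: "g \<in> CT" and N: "N \<ge> 1" for g :: "'a \<Rightarrow>\<^sub>C 'a" and N
  proof -
    obtain h :: "'a \<times> nat \<Rightarrow> 'a" where h: "homeomorphic_map (suspension_space N) euclidean h"
      using suspension_space_homeomorphic[OF X N] by blast
    have "continuous_on UNIV (apply_bcontfun g)" "surj (apply_bcontfun g)"
      using g by (auto simp: CT_def Cs_def intro: continuous_intros)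
    then show ?thesis
      by (intro isomorphic_to_exists[OF cX h] continuous_map_suspension[OF N] suspension_surj[OF N])
  qed
  have dense: "(\<Union>n\<in>{1..}. conj_class (G n)) \<subseteq> CT \<and>
      CT \<subseteq> (top_of_set Cs) closure_of (\<Union>n\<in>{1..}. conj_class (G n))"
    if g: "g \<in> CT" and G: "\<forall>n\<ge>1. G n \<in> Cs \<and>
      isomorphic_to (G n) (suspension_space (fact n)) (suspension (fact n) (apply_bcontfun g))"
    for g :: "'a \<Rightarrow>\<^sub>C 'a" and G :: "nat \<Rightarrow> 'a \<Rightarrow>\<^sub>C 'a"
  proof
    have "G n \<in> CT" if "n \<ge> 1" for n
      using suspension_CT[OF cX g _ _, of "fact n" "G n"] G that by simp
    then show "(\<Union>n\<in>{1..}. conj_class (G n)) \<subseteq> CT"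
      using conj_class_subset_CT[OF cX] by (simp add: UN_subset_iff)
    have "\<exists>F\<in>G ` {1..}. \<exists>c. cyclic_factor (apply_bcontfun F) L c" if L: "L \<ge> 1" for L
    proof -
      have "L dvd fact L"
        using L by (intro dvd_fact) auto
      then have "\<exists>c. cyclic_factor (apply_bcontfun (G L)) L c"
        using G L by (intro suspension_cyclic_factor[where N = "fact L" and g = "apply_bcontfun g"]) auto
      then show ?thesis
        using L by auto
    qed
    then have "CT \<subseteq> (top_of_set Cs) closure_of (\<Union>F\<in>G ` {1..}. conj_class F)"
      using G by (intro CT_subset_closure[OF X]) auto
    then show "CT \<subseteq> (top_of_set Cs) closure_of (\<Union>n\<in>{1..}. conj_class (G n))"
      by simp
  qed
  show ?thesis
    using CT
    by (intro conjI allI impI ballI cyc_invertible_shimomura_sequence cyc_factoring_property machine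
        residual transitive suspension dense[THEN conjunct1] dense[THEN conjunct2]) (auto simp: fact_ge_1 intro: div)
qed

end
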